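(* Let $Q=\{u\in W\mid u\le w_0w_\bullet\}$ with the Bruhat order inherited from $W$, let $Q^{\mathrm{opp}}$ be the opposite poset, and let $P=\{(v,w)\mid v\in W_{I_\bullet},\ w\in W^{I_\bullet},\ v\le w\}$ with the partial order $\preceq$ given in the context. Then the map $$\phi:P\longrightarrow Q^{\mathrm{opp}},\qquad (v,w)\longmapsto v\,\theta(w^{-1})\,w^\bullet=v\,w_\bullet\,\tau(w^{-1})\,w_0=w_\bullet\,\tau(v)\,\tau(w^{-1})\,w_0$$ is an isomorphism of posets.
   Context: $G$ is a connected reductive algebraic group over $\mathbb C$, split over $\mathbb R$, with split maximal torus $T$, Borel subgroup $B^+\supset T$, character and cocharacter lattices $X,Y$ of $T$, simple roots $\alpha_i$ and simple coroots $\alpha_i^\vee$ ($i\in I$), Weyl group $W$ with length function, Bruhat order $\le$ and longest element $w_0$. An $\imath$-root datum of type $(I=I_\bullet\sqcup I_\circ,\tau)$ is fixed: $\tau$ is an involution of $I$ preserving $I_\bullet$ and $I_\circ$; $W_{I_\bullet}$ is the parabolic subgroup of $W$ generated by $I_\bullet$, with longest element $w_\bullet$; $\theta$ is an involution of $X$, with the corresponding involution of $Y$ preserving the pairing, such that $\theta(\alpha_i)=-w_\bullet(\alpha_{\tau(i)})$ for all $i\in I$; the map $-w_\bullet\theta$ is an involutive automorphism of the based root datum inducing $\tau$ on $I$ (it induces an automorphism of $W$, also denoted $\tau$); $\theta(\alpha_i)=\alpha_i$ for $i\in I_\bullet$; and $w_0w_\bullet=w_\bullet w_0$. Standing assumption: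 $(-1)^{\langle 2\rho_\bullet^\vee,\alpha_i\rangle}=1$ for all $i\in I$, where $\rho_\bullet^\vee$ is the half sum of positive coroots of the root subsystem generated by $I_\bullet$. The involution induced on $W$ is $\theta(w)=w_\bullet\tau(w)w_\bullet^{-1}$. Put $w^\bullet=w_0w_\bullet$, so $(w^\bullet)^{-1}=w^\bullet$. $W^{I_\bullet}$ is the set of minimal-length representatives of $W/W_{I_\bullet}$. Partial order on $P$: $(v',w')\preceq(v,w)$ if and only if there exists $z\in W_{I_\bullet}$ such that $v\le v'z\le w'z\le w$. *)

theory Defs
  imports Complex_Main "HOL-Algebra.Bij" "HOL-Algebra.Generated_Groups"
begin

section \<open>Based root data\<close>

text \<open>Integer multiples, making every abelian group a module over the integers.\<close>

definition zscale :: "int \<Rightarrow> 'a::ab_group_add \<Rightarrow> 'a" where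
  "zscale k x = (if 0 \<le> k then ((+) x ^^ nat k) 0 else - (((+) x ^^ nat (- k)) 0))"

lemma funpow_add_zero: "((+) x ^^ n) 0 + y = ((+) x ^^ n) (y::'a::ab_group_add)"
  by (induction n) (simp_all add: add.assoc)

lemma zscale_of_nat_diff: "zscale (int m - int n) x = ((+) x ^^ m) 0 - ((+) x ^^ n) 0"
proof (cases "n \<le> m")
  case True
  then obtain d where d: "m = n + d" using le_Suc_ex by blast
  have "((+) x ^^ m) 0 = ((+) x ^^ n) 0 + ((+) x ^^ d) 0"
    unfolding d funpow_add o_def by (rule funpow_add_zero[symmetric])
  then show ?thesis using d by (simp add: zscale_def)
next
  case False
  then obtain d where d: "n = m + Suc d"
    using less_imp_Suc_add[of m n] by auto
  have "((+) x ^^ n) 0 = ((+) x ^^ m) 0 + ((+) x ^^ Suc d) 0"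
    unfolding d funpow_add o_def by (rule funpow_add_zero[symmetric])
  moreover have "int m - int n = - int (Suc d)" using d by simp
  ultimately show ?thesis by (simp only: zscale_def) (simp del: funpow.simps of_nat_Suc)
qed

lemma module_zscale: "module zscale"
proof
  fix a b :: int and x y :: "'a::ab_group_add"
  have ex: "\<exists>m n. k = int m - int n" for k :: int
    by (metis int_diff_cases)
  have nat_add: "((+) x ^^ (m + n)) 0 = ((+) x ^^ m) 0 + ((+) x ^^ n) 0" for m n and x :: 'a
    by (simp add: funpow_add funpow_add_zero)
  show add: "zscale (a + b) x = zscale a x + zscale b x" for a b :: int and x :: 'a
  proof -
    obtain m n p q where ab: "a = int m - int n" "b = int p - int q" using ex by meson
    have "a + b = int (m + p) - int (n + q)" using ab by simp
    then have "zscale (a + b) x = ((+) x ^^ (m + p)) 0 - ((+) x ^^ (n + q)) 0"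
      by (simp only: zscale_of_nat_diff)
    then show ?thesis unfolding ab zscale_of_nat_diff nat_add by (simp add: algebra_simps)
  qed
  have nat_dist: "((+) (x + y) ^^ n) 0 = ((+) x ^^ n) 0 + ((+) y ^^ n) 0" for n
    by (induction n) (simp_all add: algebra_simps)
  show "zscale a (x + y) = zscale a x + zscale a y"
    by (simp add: zscale_def nat_dist)
  show one: "zscale 1 x = x" for x :: 'a by (simp add: zscale_def)
  have neg: "zscale (- k) x = - zscale k x" for k and x :: 'a
    using add[of "- k" k x] by (simp add: zscale_def eq_neg_iff_add_eq_0)
  have nat_mult: "zscale (int n) (zscale b x) = zscale (int n * b) x" for n
  proof (induction n)
    case 0
    then show ?case by (simp add: zscale_def)
  next
    case (Suc n)
    have "zscale (int (Suc n)) (zscale b x) = zscale b x + zscale (int n) (zscale b x)"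
      using add[of 1 "int n"] one by simp
    also have "\<dots> = zscale (b + int n * b) x" using Suc add by simp
    finally show ?case by (simp add: algebra_simps)
  qed
  show "zscale a (zscale b x) = zscale (a * b) x"
  proof (cases a rule: int_cases2)
    case (nonneg n)
    then show ?thesis using nat_mult by simp
  next
    case (nonpos n)
    then show ?thesis using nat_mult[of n] neg by simp
  qed
qed

definition free_finite_rank :: "'a::ab_group_add itself \<Rightarrow> bool" where
  "free_finite_rank _ \<longleftrightarrow>
     (\<exists>B::'a set. finite B \<and> \<not> module.dependent zscale B \<and> module.span zscale B = UNIV)"

text \<open>
  A connected reductive group with split maximal torus T and Borel subgroup enters through its
  based root datum. The types \<open>'x\<close> and \<open>'y\<close> are the character lattice X and the cocharacter
  lattice Y of T; \<open>coroot\<close> is the bijection from roots to coroots and is only relevant on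
  \<open>roots\<close>; \<open>simple_root i\<close> is only relevant for \<open>i\<close> in the finite set \<open>nodes\<close>, which is I.
\<close>

record ('x, 'y, 'i) based_root_datum =
  pairing :: "'x \<Rightarrow> 'y \<Rightarrow> int"
  roots :: "'x set"
  coroot :: "'x \<Rightarrow> 'y"
  nodes :: "'i set"
  simple_root :: "'i \<Rightarrow> 'x"

definition simple_coroot :: "('x, 'y, 'i, 'r) based_root_datum_scheme \<Rightarrow> 'i \<Rightarrow> 'y" where
  "simple_coroot D i = coroot D (simple_root D i)"

definition reflection ::
    "('x::ab_group_add, 'y, 'i, 'r) based_root_datum_scheme \<Rightarrow> 'x \<Rightarrow> 'x \<Rightarrow> 'x" where
  "reflection D b x = x - zscale (pairing D x (coroot D b)) b"

definition coreflection ::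
    "('x, 'y::ab_group_add, 'i, 'r) based_root_datum_scheme \<Rightarrow> 'x \<Rightarrow> 'y \<Rightarrow> 'y" where
  "coreflection D b y = y - zscale (pairing D b y) (coroot D b)"

text \<open>The roots that are nonnegative integral combinations of the simple roots indexed by J;
  for \<open>J = nodes D\<close> these are the positive roots.\<close>

definition positive_roots ::
    "('x::ab_group_add, 'y, 'i, 'r) based_root_datum_scheme \<Rightarrow> 'i set \<Rightarrow> 'x set" where
  "positive_roots D J =
     {b \<in> roots D. \<exists>c::'i \<Rightarrow> nat. b = (\<Sum>j\<in>J. zscale (int (c j)) (simple_root D j))}"

locale based_root_datum =
  fixes D :: "('x::ab_group_add, 'y::ab_group_add, 'i, 'r) based_root_datum_scheme"
  assumes free_X: "free_finite_rank TYPE('x)"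
    and free_Y: "free_finite_rank TYPE('y)"
    and pairing_left: "additive (\<lambda>x. pairing D x y)"
    and pairing_right: "additive (pairing D x)"
    and perfect_left: "additive f \<Longrightarrow> \<exists>!y. \<forall>x. f x = pairing D x y"
    and perfect_right: "additive g \<Longrightarrow> \<exists>!x. \<forall>y. g y = pairing D x y"
    and finite_roots: "finite (roots D)"
    and inj_coroot: "inj_on (coroot D) (roots D)"
    and pairing_root_coroot: "b \<in> roots D \<Longrightarrow> pairing D b (coroot D b) = 2"
    and reflection_roots: "b \<in> roots D \<Longrightarrow> reflection D b ` roots D = roots D"
    and coreflection_coroots:
      "b \<in> roots D \<Longrightarrow> coreflection D b ` (coroot D ` roots D) = coroot D ` roots D"
    and reduced: "b \<in> roots D \<Longrightarrow> b + b \<notin> roots D"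
    and finite_nodes: "finite (nodes D)"
    and simple_roots: "simple_root D ` nodes D \<subseteq> roots D"
    and inj_simple_root: "inj_on (simple_root D) (nodes D)"
    and independent_simple_roots: "\<not> module.dependent zscale (simple_root D ` nodes D)"
    and positive_or_negative:
      "b \<in> roots D \<Longrightarrow> b \<in> positive_roots D (nodes D) \<or> - b \<in> positive_roots D (nodes D)"


section \<open>Weyl group, length and Bruhat order\<close>

text \<open>The Weyl group acts faithfully on X and is realised as a group of bijections of X, with
  product \<open>\<circ>\<close> and inverse \<open>inv_into UNIV\<close>.\<close>

definition weyl_group ::
    "('x::ab_group_add, 'y, 'i, 'r) based_root_datum_scheme \<Rightarrow> ('x \<Rightarrow> 'x) set" where
  "weyl_group D = generate (BijGroup UNIV) (reflection D ` roots D)"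

definition parabolic ::
    "('x::ab_group_add, 'y, 'i, 'r) based_root_datum_scheme \<Rightarrow> 'i set \<Rightarrow> ('x \<Rightarrow> 'x) set" where
  "parabolic D J = generate (BijGroup UNIV) ((\<lambda>j. reflection D (simple_root D j)) ` J)"

definition word_product ::
    "('x::ab_group_add, 'y, 'i, 'r) based_root_datum_scheme \<Rightarrow> 'i list \<Rightarrow> 'x \<Rightarrow> 'x" where
  "word_product D is = foldr (\<lambda>i w. reflection D (simple_root D i) \<circ> w) is id"

definition weyl_length ::
    "('x::ab_group_add, 'y, 'i, 'r) based_root_datum_scheme \<Rightarrow> ('x \<Rightarrow> 'x) \<Rightarrow> nat" where
  "weyl_length D w =
     (LEAST n. \<exists>is. length is = n \<and> set is \<subseteq> nodes D \<and> w = word_product D is)"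

definition bruhat_step ::
    "('x::ab_group_add, 'y, 'i, 'r) based_root_datum_scheme \<Rightarrow> ('x \<Rightarrow> 'x) rel" where
  "bruhat_step D = {(u, reflection D b \<circ> u) |u b. u \<in> weyl_group D \<and> b \<in> roots D \<and>
      weyl_length D u < weyl_length D (reflection D b \<circ> u)}"

definition bruhat_le ::
    "('x::ab_group_add, 'y, 'i, 'r) based_root_datum_scheme \<Rightarrow> ('x \<Rightarrow> 'x) \<Rightarrow> ('x \<Rightarrow> 'x) \<Rightarrow> bool"
  where
  "bruhat_le D u w \<longleftrightarrow> u \<in> weyl_group D \<and> w \<in> weyl_group D \<and> (u, w) \<in> (bruhat_step D)\<^sup>*"

definition longest_in ::
    "('x::ab_group_add, 'y, 'i, 'r) based_root_datum_scheme \<Rightarrow> 'i set \<Rightarrow> 'x \<Rightarrow> 'x" where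
  "longest_in D J = arg_max_on (weyl_length D) (parabolic D J)"

definition longest_element ::
    "('x::ab_group_add, 'y, 'i, 'r) based_root_datum_scheme \<Rightarrow> 'x \<Rightarrow> 'x" where
  "longest_element D = arg_max_on (weyl_length D) (weyl_group D)"

definition min_coset_reps ::
    "('x::ab_group_add, 'y, 'i, 'r) based_root_datum_scheme \<Rightarrow> 'i set \<Rightarrow> ('x \<Rightarrow> 'x) set" where
  "min_coset_reps D J =
     {w \<in> weyl_group D. \<forall>z\<in>parabolic D J. weyl_length D w \<le> weyl_length D (w \<circ> z)}"

text \<open>The action on Y of a bijective endomorphism of X that preserves the pairing.\<close>

definition contragredient ::
    "('x, 'y, 'i, 'r) based_root_datum_scheme \<Rightarrow> ('x \<Rightarrow> 'x) \<Rightarrow> 'y \<Rightarrow> 'y" where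
  "contragredient D f y = (THE y'. \<forall>x. pairing D (f x) y' = pairing D x y)"

text \<open>An automorphism, given by \<open>f\<close> on X and \<open>g\<close> on Y, that induces \<open>p\<close> on I.\<close>

definition based_automorphism ::
    "('x::ab_group_add, 'y::ab_group_add, 'i, 'r) based_root_datum_scheme \<Rightarrow>
      ('x \<Rightarrow> 'x) \<Rightarrow> ('y \<Rightarrow> 'y) \<Rightarrow> ('i \<Rightarrow> 'i) \<Rightarrow> bool" where
  "based_automorphism D f g p \<longleftrightarrow>
     additive f \<and> bij f \<and> additive g \<and> bij g \<and>
     (\<forall>x y. pairing D (f x) (g y) = pairing D x y) \<and>
     f ` roots D = roots D \<and> (\<forall>b\<in>roots D. coroot D (f b) = g (coroot D b)) \<and>
     bij_betw p (nodes D) (nodes D) \<and>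
     (\<forall>i\<in>nodes D. f (simple_root D i) = simple_root D (p i)) \<and>
     (\<forall>i\<in>nodes D. g (simple_coroot D i) = simple_coroot D (p i))"


section \<open>\<open>\<imath>\<close>-root data\<close>

record ('x, 'y, 'i) i_root_datum = "('x, 'y, 'i) based_root_datum" +
  black :: "'i set"
  tau :: "'i \<Rightarrow> 'i"
  theta :: "'x \<Rightarrow> 'x"
  theta_Y :: "'y \<Rightarrow> 'y"

abbreviation w0 ::
    "('x::ab_group_add, 'y, 'i, 'r) based_root_datum_scheme \<Rightarrow> 'x \<Rightarrow> 'x" where
  "w0 D \<equiv> longest_element D"

abbreviation w_black ::
    "('x::ab_group_add, 'y, 'i, 'r) i_root_datum_scheme \<Rightarrow> 'x \<Rightarrow> 'x" where
  "w_black D \<equiv> longest_in D (black D)"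

definition w_upper ::
    "('x::ab_group_add, 'y, 'i, 'r) i_root_datum_scheme \<Rightarrow> 'x \<Rightarrow> 'x" where
  "w_upper D = w0 D \<circ> w_black D"

text \<open>The diagram automorphism \<open>- w\<^sub>\<bullet> \<theta>\<close> on X and on Y.\<close>

definition diagram_X ::
    "('x::ab_group_add, 'y, 'i, 'r) i_root_datum_scheme \<Rightarrow> 'x \<Rightarrow> 'x" where
  "diagram_X D x = - w_black D (theta D x)"

definition diagram_Y ::
    "('x::ab_group_add, 'y::ab_group_add, 'i, 'r) i_root_datum_scheme \<Rightarrow> 'y \<Rightarrow> 'y" where
  "diagram_Y D y = - contragredient D (w_black D) (theta_Y D y)"

definition two_rho_black ::
    "('x::ab_group_add, 'y::ab_group_add, 'i, 'r) i_root_datum_scheme \<Rightarrow> 'y" where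
  "two_rho_black D = (\<Sum>b\<in>positive_roots D (black D). coroot D b)"

locale i_root_datum = based_root_datum D
  for D :: "('x::ab_group_add, 'y::ab_group_add, 'i, 'r) i_root_datum_scheme" +
  assumes black_nodes: "black D \<subseteq> nodes D"
    and tau_tau: "i \<in> nodes D \<Longrightarrow> tau D (tau D i) = i"
    and tau_black: "tau D ` black D = black D"
    and tau_white: "tau D ` (nodes D - black D) = nodes D - black D"
    and additive_theta: "additive (theta D)"
    and theta_theta: "theta D (theta D x) = x"
    and additive_theta_Y: "additive (theta_Y D)"
    and theta_Y_theta_Y: "theta_Y D (theta_Y D y) = y"
    and pairing_theta: "pairing D (theta D x) (theta_Y D y) = pairing D x y"
    and theta_simple_root:
      "i \<in> nodes D \<Longrightarrow> theta D (simple_root D i) = - w_black D (simple_root D (tau D i))"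
    and automorphism: "based_automorphism D (diagram_X D) (diagram_Y D) (tau D)"
    and involutive_X: "diagram_X D (diagram_X D x) = x"
    and involutive_Y: "diagram_Y D (diagram_Y D y) = y"
    and theta_black: "i \<in> black D \<Longrightarrow> theta D (simple_root D i) = simple_root D i"
    and longest_commute: "w0 D \<circ> w_black D = w_black D \<circ> w0 D"
    and parity:
      "i \<in> nodes D \<Longrightarrow> (-1 :: rat) powi pairing D (simple_root D i) (two_rho_black D) = 1"

text \<open>The automorphism of W induced by the diagram automorphism is conjugation by the latter;
  it maps the simple reflection \<open>s\<^sub>i\<close> to \<open>s\<^bsub>\<tau> i\<^esub>\<close>.\<close>

definition tau_W ::
    "('x::ab_group_add, 'y, 'i, 'r) i_root_datum_scheme \<Rightarrow> ('x \<Rightarrow> 'x) \<Rightarrow> 'x \<Rightarrow> 'x" where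
  "tau_W D w = diagram_X D \<circ> w \<circ> inv_into UNIV (diagram_X D)"

definition theta_W ::
    "('x::ab_group_add, 'y, 'i, 'r) i_root_datum_scheme \<Rightarrow> ('x \<Rightarrow> 'x) \<Rightarrow> 'x \<Rightarrow> 'x" where
  "theta_W D w = w_black D \<circ> tau_W D w \<circ> inv_into UNIV (w_black D)"


section \<open>The posets and the map\<close>

text \<open>A poset is given by its carrier \<open>A\<close> and the set of pairs \<open>(a, b)\<close> with \<open>a \<le> b\<close>, so that the
  opposite poset is given by the converse relation.\<close>

definition poset_iso :: "'a set \<Rightarrow> 'a rel \<Rightarrow> 'b set \<Rightarrow> 'b rel \<Rightarrow> ('a \<Rightarrow> 'b) \<Rightarrow> bool" where
  "poset_iso A r B s f \<longleftrightarrow>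
     partial_order_on A r \<and> partial_order_on B s \<and> bij_betw f A B \<and>
     (\<forall>a\<in>A. \<forall>a'\<in>A. (a, a') \<in> r \<longleftrightarrow> (f a, f a') \<in> s)"

definition Q_set ::
    "('x::ab_group_add, 'y, 'i, 'r) i_root_datum_scheme \<Rightarrow> ('x \<Rightarrow> 'x) set" where
  "Q_set D = {u \<in> weyl_group D. bruhat_le D u (w0 D \<circ> w_black D)}"

definition Q_order ::
    "('x::ab_group_add, 'y, 'i, 'r) i_root_datum_scheme \<Rightarrow> ('x \<Rightarrow> 'x) rel" where
  "Q_order D = {(u, u'). u \<in> Q_set D \<and> u' \<in> Q_set D \<and> bruhat_le D u u'}"

definition P_set ::
    "('x::ab_group_add, 'y, 'i, 'r) i_root_datum_scheme \<Rightarrow> (('x \<Rightarrow> 'x) \<times> ('x \<Rightarrow> 'x)) set" where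
  "P_set D =
     {(v, w). v \<in> parabolic D (black D) \<and> w \<in> min_coset_reps D (black D) \<and> bruhat_le D v w}"

definition P_order ::
    "('x::ab_group_add, 'y, 'i, 'r) i_root_datum_scheme \<Rightarrow> (('x \<Rightarrow> 'x) \<times> ('x \<Rightarrow> 'x)) rel" where
  "P_order D =
     {((v', w'), (v, w)). (v', w') \<in> P_set D \<and> (v, w) \<in> P_set D \<and>
       (\<exists>z\<in>parabolic D (black D).
          bruhat_le D v (v' \<circ> z) \<and> bruhat_le D (v' \<circ> z) (w' \<circ> z) \<and> bruhat_le D (w' \<circ> z) w)}"

definition phi ::
    "('x::ab_group_add, 'y, 'i, 'r) i_root_datum_scheme \<Rightarrow>
      ('x \<Rightarrow> 'x) \<times> ('x \<Rightarrow> 'x) \<Rightarrow> 'x \<Rightarrow> 'x" where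
  "phi D = (\<lambda>(v, w). v \<circ> theta_W D (inv_into UNIV w) \<circ> w_upper D)"

end

theory Submission
  imports Defs "HOL-Library.Sublist"
begin

text \<open>
  Sending \<open>y\<close> to \<open>\<tau>(y)\<^sup>-\<^sup>1 w\<^sub>0\<close> reverses the Bruhat order on \<open>W\<close>, exchanges \<open>w\<^sub>\<bullet>\<close> with
  \<open>w\<^sub>0 w\<^sub>\<bullet>\<close>, and sends \<open>w v\<^sup>-\<^sup>1 w\<^sub>\<bullet>\<close> to \<open>\<phi>(v, w)\<close>, because \<open>w\<^sub>\<bullet> \<tau>(v) = v w\<^sub>\<bullet>\<close> for \<open>v\<close> in the black
  parabolic subgroup. So it suffices to compare \<open>P\<close> with the interval above \<open>w\<^sub>\<bullet>\<close> via
  \<open>(v, w) \<mapsto> w \<cdot> v\<^sup>-\<^sup>1 w\<^sub>\<bullet>\<close>, which is a length-additive factorisation along the cosets of the black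
  parabolic subgroup. By the subword property, \<open>w' c' \<le> w c\<close> for such factorisations holds if and
  only if some \<open>z\<close> in the subgroup satisfies \<open>w' z \<le> w\<close> and \<open>z\<^sup>-\<^sup>1 c' \<le> c\<close>. For
  \<open>c = v\<^sup>-\<^sup>1 w\<^sub>\<bullet>\<close> and \<open>c' = v'\<^sup>-\<^sup>1 w\<^sub>\<bullet>\<close> the last condition is \<open>v \<le> v' z\<close>, since multiplication by
  \<open>w\<^sub>\<bullet>\<close> reverses the order on the subgroup; the remaining condition \<open>v' z \<le> w' z\<close> follows from
  \<open>v' \<le> w'\<close>. Taking \<open>w' = 1\<close>, \<open>c' = w\<^sub>\<bullet>\<close> shows that \<open>w v\<^sup>-\<^sup>1 w\<^sub>\<bullet> \<ge> w\<^sub>\<bullet>\<close> means \<open>v \<le> w\<close>.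
\<close>

section \<open>Roots and reflections\<close>

interpretation zmod: module "zscale :: int \<Rightarrow> 'a::ab_group_add \<Rightarrow> 'a"
  by (rule module_zscale)

lemma zscale_of_nat_Suc: "zscale (int (Suc n)) x = x + zscale (int n) x"
  using zmod.scale_left_distrib[of 1 "int n" x] by simp

lemma additive_zscale:
  assumes "additive f"
  shows "f (zscale k x) = zscale k (f x)"
proof -
  interpret additive f by (fact assms)
  have nat: "f (zscale (int n) x) = zscale (int n) (f x)" for n
    by (induction n) (simp_all only: zscale_of_nat_Suc add, simp add: zero)
  show ?thesis
    by (cases k rule: int_cases2) (simp_all only: nat zmod.scale_minus_left minus)
qed

lemma zscale_int: "zscale k (n::int) = k * n"
proof -
  have nat: "zscale (int m) n = int m * n" for m
    by (induction m) (simp_all only: zscale_of_nat_Suc, simp_all add: algebra_simps)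
  show ?thesis
    by (cases k rule: int_cases2) (simp_all add: nat)
qed

context based_root_datum
begin

abbreviation simple :: "'i \<Rightarrow> 'x" ("\<alpha>") where "\<alpha> \<equiv> simple_root D"
abbreviation refl_of :: "'x \<Rightarrow> 'x \<Rightarrow> 'x" ("\<sigma>") where "\<sigma> \<equiv> reflection D"
abbreviation simple_refl :: "'i \<Rightarrow> 'x \<Rightarrow> 'x" ("\<s>") where "simple_refl i \<equiv> reflection D (simple_root D i)"

lemma pairing_zscale_left: "pairing D (zscale k x) y = k * pairing D x y"
  using additive_zscale[OF pairing_left] by (simp add: zscale_int)

lemma pairing_zscale_right: "pairing D x (zscale k y) = k * pairing D x y"
  using additive_zscale[OF pairing_right] by (simp add: zscale_int)

lemmas pairing_simps =
  additive.add[OF pairing_left] additive.diff[OF pairing_left] additive.minus[OF pairing_left]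
  additive.zero[OF pairing_left] additive.sum[OF pairing_left]
  additive.add[OF pairing_right] additive.diff[OF pairing_right] additive.minus[OF pairing_right]
  additive.zero[OF pairing_right] additive.sum[OF pairing_right]
  pairing_zscale_left pairing_zscale_right

lemma reflection_root: "b \<in> roots D \<Longrightarrow> a \<in> roots D \<Longrightarrow> \<sigma> b a \<in> roots D"
  using reflection_roots by blast

lemma additive_reflection: "additive (\<sigma> b)"
  by standard (simp add: reflection_def pairing_simps zmod.scale_left_distrib)

lemma zscale_2: "zscale 2 x = x + x"
  using zmod.scale_left_distrib[of 1 1 x] by simp

lemma reflection_self: "b \<in> roots D \<Longrightarrow> \<sigma> b b = - b"
  by (simp add: reflection_def pairing_root_coroot zscale_2)

lemma root_nonzero: "b \<in> roots D \<Longrightarrow> b \<noteq> 0"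
  using pairing_root_coroot[of b] by (auto simp: pairing_simps)

lemma reflection_reflection: "b \<in> roots D \<Longrightarrow> \<sigma> b (\<sigma> b x) = x"
  by (simp add: reflection_def pairing_simps pairing_root_coroot
      zmod.scale_left_diff_distrib zmod.scale_minus_left)

lemma reflection_o_reflection: "b \<in> roots D \<Longrightarrow> \<sigma> b \<circ> \<sigma> b = id"
  by (rule ext) (simp add: reflection_reflection)

lemma coreflection_coreflection:
  "b \<in> roots D \<Longrightarrow> coreflection D b (coreflection D b y) = y"
  by (simp add: coreflection_def pairing_simps pairing_root_coroot
      zmod.scale_left_diff_distrib zmod.scale_minus_left)

lemma pairing_reflection:
  "pairing D (\<sigma> b x) y = pairing D x (coreflection D b y)"
  by (simp add: reflection_def coreflection_def pairing_simps mult.commute)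

lemma bij_reflection: "b \<in> roots D \<Longrightarrow> bij (\<sigma> b)"
  by (rule o_bij[of "\<sigma> b"]) (simp_all add: reflection_o_reflection)

text \<open>This is the map \<open>X \<rightarrow> Y\<close> of the invariant form \<open>(x, y) \<mapsto> \<Sum>\<^sub>c \<langle>x, c\<rangle>\<langle>y, c\<rangle>\<close>. The form is
  positive on roots, so by \<open>polar_root\<close> the map determines each coroot from its root.\<close>

definition polar :: "'x \<Rightarrow> 'y" where
  "polar x = (\<Sum>c\<in>coroot D ` roots D. zscale (pairing D x c) c)"

lemma pairing_polar: "pairing D x (polar y) = (\<Sum>c\<in>coroot D ` roots D. pairing D y c * pairing D x c)"
  by (simp add: polar_def pairing_simps)

lemma polar_reflection:
  assumes "b \<in> roots D"
  shows "polar (\<sigma> b x) = coreflection D b (polar x)"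
proof -
  let ?R = "coroot D ` roots D" and ?t = "coreflection D b"
  have inj: "inj_on ?t ?R"
    by (rule inj_on_inverseI[of _ ?t]) (simp add: coreflection_coreflection assms)
  have add: "additive ?t"
    by standard (simp add: coreflection_def pairing_simps zmod.scale_left_distrib)
  have "polar (\<sigma> b x) = (\<Sum>c\<in>?R. zscale (pairing D x (?t c)) c)"
    by (simp add: polar_def pairing_reflection)
  also have "\<dots> = (\<Sum>c\<in>?t ` ?R. zscale (pairing D x (?t c)) c)"
    using coreflection_coroots[OF assms] by simp
  also have "\<dots> = (\<Sum>c\<in>?R. zscale (pairing D x c) (?t c))"
    by (subst sum.reindex[OF inj]) (simp add: coreflection_coreflection assms)
  also have "\<dots> = ?t (polar x)"
    unfolding polar_def by (simp add: additive.sum[OF add] additive_zscale[OF add])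
  finally show ?thesis .
qed

text \<open>Since \<open>polar\<close> is odd and intertwines reflection with coreflection, applying
  it to \<open>\<sigma> b b = - b\<close> isolates twice \<open>polar b\<close> as a multiple of the
  coroot.\<close>

lemma polar_root:
  assumes "b \<in> roots D"
  shows "zscale 2 (polar b) = zscale (pairing D b (polar b)) (coroot D b)"
proof -
  have "polar (- b) = - polar b"
    by (simp add: polar_def pairing_simps sum_negf)
  then have "- polar b = polar b - zscale (pairing D b (polar b)) (coroot D b)"
    using polar_reflection[OF assms, of b] by (simp add: reflection_self assms coreflection_def)
  then have "polar b + polar b = zscale (pairing D b (polar b)) (coroot D b)"
    by (simp add: algebra_simps)
  then show ?thesis by (simp add: zscale_2)
qed

text \<open>Every summand is a square, and the coroot of \<open>b\<close> itself contributes
  4.\<close>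

lemma pairing_polar_pos:
  assumes "b \<in> roots D"
  shows "0 < pairing D b (polar b)"
  unfolding pairing_polar using assms
  by (intro sum_pos2[of _ "coroot D b"]) (auto simp: finite_roots pairing_root_coroot)

text \<open>The axioms say that a coreflection permutes the coroots, but not which root each image
  belongs to. The link comes from \<open>polar\<close>: a reflection preserves the norm
  \<open>?q\<close> of \<open>b\<close>, so the formulas of \<open>polar_root\<close> for both roots
  can be compared and \<open>?q\<close> cancelled.\<close>

lemma pairing_reflection_coroot:
  assumes "a \<in> roots D" "b \<in> roots D"
  shows "pairing D (\<sigma> a x) (coroot D (\<sigma> a b)) = pairing D x (coroot D b)"
proof -
  let ?q = "pairing D b (polar b)"
  have q: "pairing D (\<sigma> a b) (polar (\<sigma> a b)) = ?q"
    by (simp add: polar_reflection pairing_reflection coreflection_coreflection assms)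
  have "?q * pairing D (\<sigma> a x) (coroot D (\<sigma> a b)) = 2 * pairing D (\<sigma> a x) (polar (\<sigma> a b))"
    using polar_root[OF reflection_root[OF assms]] q by (metis pairing_zscale_right)
  also have "\<dots> = 2 * pairing D x (polar b)"
    by (simp add: polar_reflection pairing_reflection coreflection_coreflection assms)
  also have "\<dots> = ?q * pairing D x (coroot D b)"
    using polar_root[OF assms(2)] by (metis pairing_zscale_right)
  finally show ?thesis using pairing_polar_pos[OF assms(2)] by simp
qed

lemma reflection_conj:
  assumes "a \<in> roots D" "b \<in> roots D"
  shows "\<sigma> a \<circ> \<sigma> b = \<sigma> (\<sigma> a b) \<circ> \<sigma> a"
proof (rule ext, unfold o_apply)
  fix x
  have "\<sigma> a (\<sigma> b x) = \<sigma> a x - zscale (pairing D x (coroot D b)) (\<sigma> a b)"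
    by (simp add: reflection_def[of D b] additive.diff[OF additive_reflection]
        additive_zscale[OF additive_reflection])
  also have "\<dots> = \<sigma> (\<sigma> a b) (\<sigma> a x)"
    by (simp add: reflection_def[of D "\<sigma> a b"] pairing_reflection_coroot assms)
  finally show "\<sigma> a (\<sigma> b x) = \<sigma> (\<sigma> a b) (\<sigma> a x)" .
qed

lemma reflection_uminus: "b \<in> roots D \<Longrightarrow> \<sigma> (- b) = \<sigma> b"
  using reflection_conj[of b b]
  by (metis comp_assoc comp_id id_comp reflection_o_reflection reflection_self)

section \<open>Coordinates in the simple roots and positivity\<close>

abbreviation comb :: "('i \<Rightarrow> int) \<Rightarrow> 'x" where
  "comb c \<equiv> \<Sum>j\<in>nodes D. zscale (c j) (\<alpha> j)"

lemma comb_eq_0D: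
  assumes "comb c = 0" "j \<in> nodes D"
  shows "c j = 0"
proof -
  \<comment> \<open>Linear independence is stated for coefficients indexed by vectors, so
    \<open>c\<close> is transported along the injection of nodes into roots.\<close>
  let ?u = "\<lambda>v. c (inv_into (nodes D) \<alpha> v)"
  have "(\<Sum>v\<in>\<alpha> ` nodes D. zscale (?u v) v) = comb c"
    by (subst sum.reindex[OF inj_simple_root]) (simp add: inj_simple_root)
  then have "?u (\<alpha> j) = 0"
    using zmod.independentD[OF independent_simple_roots, of "\<alpha> ` nodes D" ?u "\<alpha> j"] assms finite_nodes
    by simp
  then show ?thesis using assms(2) by (simp add: inj_simple_root)
qed

lemma comb_diff: "comb c - comb d = comb (\<lambda>j. c j - d j)"
  by (simp add: zmod.scale_left_diff_distrib sum_subtractf)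

lemma comb_eqD: "comb c = comb d \<Longrightarrow> j \<in> nodes D \<Longrightarrow> c j = d j"
  using comb_eq_0D[of "\<lambda>j. c j - d j" j] by (simp add: comb_diff[symmetric])

lemma comb_uminus: "- comb c = comb (\<lambda>j. - c j)"
  by (simp add: sum_negf)

lemma comb_single: "i \<in> nodes D \<Longrightarrow> comb (\<lambda>j. if j = i then k else 0) = zscale k (\<alpha> i)"
proof -
  assume i: "i \<in> nodes D"
  have "comb (\<lambda>j. if j = i then k else 0) = (\<Sum>j\<in>nodes D. if j = i then zscale k (\<alpha> j) else 0)"
    by (rule sum.cong) auto
  then show ?thesis using i by (simp add: finite_nodes)
qed

abbreviation pos :: "'x \<Rightarrow> bool" where "pos b \<equiv> b \<in> positive_roots D (nodes D)"

text \<open>With integer coefficients, nonnegative on \<open>nodes D\<close>, differences can be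
  formed and compared by \<open>comb_eqD\<close>.\<close>

lemma pos_iff: "pos b \<longleftrightarrow> b \<in> roots D \<and> (\<exists>c. (\<forall>j\<in>nodes D. 0 \<le> c j) \<and> b = comb c)"
proof -
  have "(\<exists>c::'i \<Rightarrow> nat. b = comb (\<lambda>j. int (c j))) \<longleftrightarrow> (\<exists>c. (\<forall>j\<in>nodes D. 0 \<le> c j) \<and> b = comb c)"
  proof safe
    fix c :: "'i \<Rightarrow> nat"
    show "\<exists>d. (\<forall>j\<in>nodes D. 0 \<le> d j) \<and> comb (\<lambda>j. int (c j)) = comb d"
      by (intro exI[of _ "\<lambda>j. int (c j)"]) simp
  next
    fix c :: "'i \<Rightarrow> int"
    assume "\<forall>j\<in>nodes D. 0 \<le> c j" "b = comb c"
    then have "comb c = comb (\<lambda>j. int ((\<lambda>j. nat (c j)) j))" by simp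
    then show "\<exists>c'::'i \<Rightarrow> nat. comb c = comb (\<lambda>j. int (c' j))"
      by (intro exI[of _ "\<lambda>j. nat (c j)"])
  qed
  then show ?thesis by (auto simp: positive_roots_def)
qed

lemma pos_root: "pos b \<Longrightarrow> b \<in> roots D"
  by (simp add: positive_roots_def)

lemma pos_or_neg: "b \<in> roots D \<Longrightarrow> pos b \<or> pos (- b)"
  by (rule positive_or_negative)

lemma not_pos_and_neg: "pos b \<Longrightarrow> \<not> pos (- b)"
proof
  assume "pos b" "pos (- b)"
  then obtain c d where c: "\<forall>j\<in>nodes D. 0 \<le> c j" "b = comb c"
    and d: "\<forall>j\<in>nodes D. 0 \<le> d j" "- b = comb d"
    unfolding pos_iff by blast
  have "comb c = comb (\<lambda>j. - d j)" using c(2) d(2) comb_uminus[of d] by (metis minus_minus)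
  then have "c j = - d j" if "j \<in> nodes D" for j
    using comb_eqD[of c "\<lambda>j. - d j"] that by blast
  then have "c j = 0" if "j \<in> nodes D" for j using c(1) d(1) that by fastforce
  then have "b = 0" using c(2) by simp
  then show False using \<open>pos b\<close> root_nonzero pos_root by blast
qed

lemma simple_root_root: "i \<in> nodes D \<Longrightarrow> \<alpha> i \<in> roots D"
  using simple_roots by blast

lemma pos_simple: "i \<in> nodes D \<Longrightarrow> pos (\<alpha> i)"
  unfolding pos_iff using comb_single[of i 1] simple_root_root[of i]
  by (intro conjI exI[of _ "\<lambda>j. if j = i then 1 else 0"]) auto

text \<open>The multiple pairs to 2 with its own coroot, so \<open>k\<close> divides 2; reducedness
  excludes 2.\<close>

lemma root_multiple_simple:
  assumes "i \<in> nodes D" "zscale k (\<alpha> i) \<in> roots D" "0 \<le> k"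
  shows "k = 1"
proof -
  let ?b = "zscale k (\<alpha> i)"
  have "k * pairing D (\<alpha> i) (coroot D ?b) = 2"
    using pairing_root_coroot[OF assms(2)] by (simp add: pairing_simps)
  then have "k dvd 2" by (metis dvd_triv_left)
  then have "k \<le> 2" by (simp add: zdvd_imp_le)
  moreover have "k \<noteq> 0" using root_nonzero[OF assms(2)] by auto
  moreover have "k \<noteq> 2"
    using reduced[OF simple_root_root[OF assms(1)]] assms(2) by (auto simp: zscale_2)
  ultimately show ?thesis using assms(3) by linarith
qed

text \<open>Reflecting in \<open>\<alpha>\<^sub>i\<close> changes only the \<open>i\<close>-th coefficient.\<close>

lemma simple_reflection_pos:
  assumes "i \<in> nodes D" "pos b" "b \<noteq> \<alpha> i"
  shows "pos (\<s> i b)"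
proof (rule ccontr)
  assume "\<not> pos (\<s> i b)"
  then have "pos (- \<s> i b)"
    using pos_or_neg reflection_root simple_root_root assms pos_root by blast
  then obtain d where d: "\<forall>j\<in>nodes D. 0 \<le> d j" "- \<s> i b = comb d" by (auto simp: pos_iff)
  obtain c where c: "\<forall>j\<in>nodes D. 0 \<le> c j" "b = comb c" using assms(2) by (auto simp: pos_iff)
  define n where "n = pairing D b (coroot D (\<alpha> i))"
  have "comb c = comb (\<lambda>j. (if j = i then n else 0) - d j)"
    using c(2) d(2) by (simp only: comb_diff[symmetric] comb_single assms(1))
      (simp add: reflection_def n_def algebra_simps)
  \<comment> \<open>Away from \<open>i\<close>, one coefficient is the negative of the other and
    both are nonnegative. So \<open>b\<close> is a multiple of the simple root.\<close>
  then have "c j = - d j" if "j \<in> nodes D" "j \<noteq> i" for j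
    using comb_eqD[of c _ j] that by fastforce
  then have z: "c j = 0" if "j \<in> nodes D" "j \<noteq> i" for j
    using c(1) d(1) that by fastforce
  then have "b = comb (\<lambda>j. if j = i then c i else 0)"
    unfolding c(2) by (intro sum.cong) auto
  then have b: "b = zscale (c i) (\<alpha> i)" by (simp only: comb_single assms(1))
  then have "c i = 1" using root_multiple_simple[of i "c i"] assms c(1) pos_root by auto
  then show False using b assms(3) by simp
qed


section \<open>The Weyl group and the exchange property\<close>

abbreviation ginv :: "('x \<Rightarrow> 'x) \<Rightarrow> 'x \<Rightarrow> 'x" where "ginv \<equiv> inv_into UNIV"
abbreviation wp :: "'i list \<Rightarrow> 'x \<Rightarrow> 'x" where "wp \<equiv> word_product D"
abbreviation W :: "('x \<Rightarrow> 'x) set" where "W \<equiv> weyl_group D"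
abbreviation WJ :: "'i set \<Rightarrow> ('x \<Rightarrow> 'x) set" where "WJ \<equiv> parabolic D"
abbreviation len :: "('x \<Rightarrow> 'x) \<Rightarrow> nat" where "len \<equiv> weyl_length D"

section \<open>Words in the simple reflections\<close>

lemma wp_Nil [simp]: "wp [] = id"
  by (simp add: word_product_def)

lemma wp_Cons [simp]: "wp (i # is) = \<s> i \<circ> wp is"
  by (simp add: word_product_def)

lemma wp_append: "wp (xs @ ys) = wp xs \<circ> wp ys"
  by (induction xs) (simp_all add: o_assoc)

lemma wp_rev_wp: "set is \<subseteq> nodes D \<Longrightarrow> wp (rev is) (wp is x) = x"
  by (induction "is") (simp_all add: wp_append reflection_reflection simple_root_root)

lemma wp_rev_o_wp: "set is \<subseteq> nodes D \<Longrightarrow> wp (rev is) \<circ> wp is = id"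
  by (rule ext) (simp add: wp_rev_wp)

lemma wp_o_wp_rev: "set is \<subseteq> nodes D \<Longrightarrow> wp is \<circ> wp (rev is) = id"
  using wp_rev_o_wp[of "rev is"] by simp

lemma bij_wp: "set is \<subseteq> nodes D \<Longrightarrow> bij (wp is)"
  by (rule o_bij[of "wp (rev is)"]) (simp_all add: wp_rev_o_wp wp_o_wp_rev)

lemma inv_wp: "set is \<subseteq> nodes D \<Longrightarrow> ginv (wp is) = wp (rev is)"
  by (rule inv_unique_comp) (simp_all add: wp_rev_o_wp wp_o_wp_rev)

lemma additive_wp: "additive (wp is)"
  by (induction "is") (auto simp: additive_def additive.add[OF additive_reflection])

lemma wp_root: "set is \<subseteq> nodes D \<Longrightarrow> b \<in> roots D \<Longrightarrow> wp is b \<in> roots D"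
  by (induction "is") (auto simp: reflection_root simple_root_root)

lemma wp_conj:
  "set is \<subseteq> nodes D \<Longrightarrow> b \<in> roots D \<Longrightarrow> wp is \<circ> \<sigma> b = \<sigma> (wp is b) \<circ> wp is"
proof (induction "is")
  case (Cons i "is")
  have "wp (i # is) \<circ> \<sigma> b = \<s> i \<circ> (wp is \<circ> \<sigma> b)"
    by (simp only: wp_Cons o_assoc)
  also have "wp is \<circ> \<sigma> b = \<sigma> (wp is b) \<circ> wp is"
    by (rule Cons.IH) (use Cons.prems in auto)
  also have "\<s> i \<circ> (\<sigma> (wp is b) \<circ> wp is) = (\<s> i \<circ> \<sigma> (wp is b)) \<circ> wp is"
    by (simp only: o_assoc)
  also have "\<dots> = \<sigma> (wp (i # is) b) \<circ> wp (i # is)"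
    using Cons.prems by (simp add: reflection_conj simple_root_root wp_root o_assoc)
  finally show ?case .
qed simp

text \<open>The generators are involutions, so an inverse generator is again a generator. Membership
  in \<open>Bij UNIV\<close> is carried along because the product of \<open>BijGroup\<close> is
  plain composition only on bijections.\<close>

lemma generate_BijGroup_closed:
  assumes gen: "f \<in> generate (BijGroup UNIV) S"
    and S: "\<And>s. s \<in> S \<Longrightarrow> s \<circ> s = id"
    and one: "P id" and incl: "\<And>s. s \<in> S \<Longrightarrow> P s"
    and comp: "\<And>g h. P g \<Longrightarrow> P h \<Longrightarrow> P (g \<circ> h)"
  shows "P (f :: 'x \<Rightarrow> 'x)"
proof -
  have bij: "s \<in> Bij UNIV" if "s \<in> S" for s
    using S[OF that] by (auto simp: Bij_def intro: o_bij)
  have "f \<in> Bij UNIV \<and> P f"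
    using gen
  proof induction
    case one
    then show ?case using \<open>P id\<close> by (simp add: BijGroup_def Bij_def restrict_UNIV flip: id_def)
  next
    case (incl h)
    then show ?case using bij assms(4) by blast
  next
    case (inv h)
    then have "inv\<^bsub>BijGroup UNIV\<^esub> h = h"
      using S[of h] bij[of h] by (simp add: inv_BijGroup inv_unique_comp restrict_UNIV)
    then show ?case using inv bij assms(4) by simp
  next
    case (eng g h)
    then show ?case using comp compose_Bij[of g UNIV h]
      by (simp add: BijGroup_def compose_def comp_def restrict_UNIV)
  qed
  then show ?thesis ..
qed

lemma generate_BijGroup_comp:
  assumes "g \<in> generate (BijGroup UNIV) S" "h \<in> generate (BijGroup UNIV) S"
    and "\<And>s. s \<in> S \<Longrightarrow> s \<circ> s = (id :: 'x \<Rightarrow> 'x)"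
  shows "g \<circ> h \<in> generate (BijGroup UNIV) S"
proof -
  have "bij f" if "f \<in> generate (BijGroup UNIV) S" for f
    using that assms(3)
    by (rule generate_BijGroup_closed) (blast intro: o_bij bij_comp bij_id assms(3))+
  then have "g \<in> Bij UNIV" "h \<in> Bij UNIV" using assms by (auto simp: Bij_def)
  then show ?thesis using generate.eng[OF assms(1,2)]
    by (simp add: BijGroup_def compose_def comp_def restrict_UNIV)
qed

lemma parabolic_eq_words:
  assumes "J \<subseteq> nodes D"
  shows "WJ J = wp ` {is. set is \<subseteq> J}"
proof (intro equalityI subsetI)
  have inv: "s \<circ> s = id" if "s \<in> (\<lambda>j. \<s> j) ` J" for s
    using that assms by (auto simp: reflection_o_reflection simple_root_root)
  fix w assume "w \<in> WJ J"
  then show "w \<in> wp ` {is. set is \<subseteq> J}"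
    unfolding parabolic_def
  proof (rule generate_BijGroup_closed[OF _ inv])
    show "id \<in> wp ` {is. set is \<subseteq> J}" by (rule image_eqI[of _ _ "[]"]) auto
  next
    fix s assume "s \<in> (\<lambda>j. \<s> j) ` J"
    then obtain j where "j \<in> J" "s = \<s> j" by blast
    then show "s \<in> wp ` {is. set is \<subseteq> J}" by (intro image_eqI[of _ _ "[j]"]) auto
  next
    fix g h assume "g \<in> wp ` {is. set is \<subseteq> J}" "h \<in> wp ` {is. set is \<subseteq> J}"
    then obtain xs ys where "g = wp xs" "set xs \<subseteq> J" "h = wp ys" "set ys \<subseteq> J" by blast
    then show "g \<circ> h \<in> wp ` {is. set is \<subseteq> J}" by (intro image_eqI[of _ _ "xs @ ys"]) (auto simp: wp_append)
  qed
next
  have inv: "s \<circ> s = id" if "s \<in> (\<lambda>j. \<s> j) ` J" for s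
    using that assms by (auto simp: reflection_o_reflection simple_root_root)
  have "wp is \<in> WJ J" if "set is \<subseteq> J" for "is"
    using that
  proof (induction "is")
    case Nil
    then show ?case unfolding parabolic_def
      using generate.one[of "BijGroup UNIV"] by (simp add: BijGroup_def restrict_UNIV flip: id_def)
  next
    case (Cons i "is")
    then have "\<s> i \<in> generate (BijGroup UNIV) ((\<lambda>j. \<s> j) ` J)" by (intro generate.incl) auto
    then show ?case using Cons unfolding parabolic_def wp_Cons
      by (intro generate_BijGroup_comp inv) auto
  qed
  then show "w \<in> wp ` {is. set is \<subseteq> J} \<Longrightarrow> w \<in> WJ J" for w by blast
qed

text \<open>Otherwise \<open>b\<close> would pair nonpositively with all simple roots, hence with itself, in the form
  of \<open>polar\<close>.\<close>

lemma exists_lowering_simple: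
  assumes "pos b"
  obtains i where "i \<in> nodes D" "0 < pairing D b (coroot D (\<alpha> i))"
proof -
  obtain c where c: "\<forall>j\<in>nodes D. 0 \<le> c j" "b = comb c" using assms by (auto simp: pos_iff)
  have "\<exists>i\<in>nodes D. 0 < pairing D b (coroot D (\<alpha> i))"
  proof (rule ccontr)
    assume *: "\<not> ?thesis"
    have "2 * pairing D (\<alpha> i) (polar b) \<le> 0" if "i \<in> nodes D" for i
    proof -
      have "2 * pairing D (\<alpha> i) (polar b) = 2 * pairing D b (polar (\<alpha> i))"
        by (simp add: pairing_polar mult.commute)
      also have "\<dots> = pairing D (\<alpha> i) (polar (\<alpha> i)) * pairing D b (coroot D (\<alpha> i))"
        using polar_root[OF simple_root_root[OF that]] by (metis pairing_zscale_right)
      also have "\<dots> \<le> 0"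
        using * that pairing_polar_pos[OF simple_root_root[OF that]] by (simp add: mult_nonneg_nonpos not_less)
      finally show ?thesis .
    qed
    then have "c i * pairing D (\<alpha> i) (polar b) \<le> 0" if "i \<in> nodes D" for i
      using that c(1) by (simp add: mult_nonneg_nonpos)
    then have "pairing D (comb c) (polar b) \<le> 0"
      unfolding pairing_simps by (simp add: sum_nonpos)
    then show False using pairing_polar_pos[OF pos_root[OF assms]] c(2) by simp
  qed
  then show ?thesis using that by blast
qed

text \<open>Induction on the height, the sum of the coefficients: unless the root is simple already,
  some simple reflection keeps it positive and lowers its height.\<close>

lemma pos_root_conj_simple:
  assumes "pos b"
  shows "\<exists>is i. set is \<subseteq> nodes D \<and> i \<in> nodes D \<and> b = wp is (\<alpha> i)"
proof -
  have *: "\<exists>is i. set is \<subseteq> nodes D \<and> i \<in> nodes D \<and> b = wp is (\<alpha> i)"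
    if "pos b" "\<forall>j\<in>nodes D. 0 \<le> c j" "b = comb c" for c b
    using that
  proof (induction "nat (\<Sum>j\<in>nodes D. c j)" arbitrary: b c rule: less_induct)
    case less
    obtain i where i: "i \<in> nodes D" "0 < pairing D b (coroot D (\<alpha> i))" (is "0 < ?n")
      using exists_lowering_simple less.prems by blast
    show ?case
    proof (cases "b = \<alpha> i")
      case True
      then show ?thesis using i by (intro exI[of _ "[]"]) auto
    next
      case False
      then have "pos (\<s> i b)" using simple_reflection_pos less.prems i by blast
      then obtain d where d: "\<forall>j\<in>nodes D. 0 \<le> d j" "\<s> i b = comb d" by (auto simp: pos_iff)
      \<comment> \<open>In coordinates the reflection subtracts the positive number
        \<open>?n\<close> from the coefficient at \<open>i\<close>.\<close>
      have eq: "comb d = comb (\<lambda>j. c j - (if j = i then ?n else 0))"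
        using less.prems(3) d(2) by (simp only: comb_diff[symmetric] comb_single i)
          (simp add: reflection_def)
      have "d j = c j - (if j = i then ?n else 0)" if "j \<in> nodes D" for j
        using comb_eqD[OF eq that] .
      then have "sum d (nodes D) = (\<Sum>j\<in>nodes D. c j - (if j = i then ?n else 0))" by simp
      also have "\<dots> = sum c (nodes D) - ?n"
        using i finite_nodes by (simp add: sum_subtractf)
      finally have "sum d (nodes D) < sum c (nodes D)" using i by simp
      moreover have "0 \<le> sum d (nodes D)" using d(1) by (simp add: sum_nonneg)
      ultimately have "nat (sum d (nodes D)) < nat (sum c (nodes D))" by simp
      from less.hyps[OF this \<open>pos (\<s> i b)\<close> d] obtain js j
        where j: "set js \<subseteq> nodes D" "j \<in> nodes D" "\<s> i b = wp js (\<alpha> j)" by blast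
      have "b = wp (i # js) (\<alpha> j)"
        using reflection_reflection[OF simple_root_root[OF i(1)], of b] j by simp
      then show ?thesis using i j by (intro exI[of _ "i # js"] exI[of _ j]) auto
    qed
  qed
  obtain c where "\<forall>j\<in>nodes D. 0 \<le> c j" "b = comb c" using assms by (auto simp: pos_iff)
  then show ?thesis by (rule *[OF assms])
qed

text \<open>If a word sends a simple root to \<open>b\<close>, conjugating the simple reflection by
  the word gives \<open>\<sigma> b\<close>. Negative roots reduce to positive ones, having the same
  reflections.\<close>

lemma reflection_word:
  assumes "b \<in> roots D"
  shows "\<exists>is. set is \<subseteq> nodes D \<and> \<sigma> b = wp is"
proof -
  have *: "\<exists>is. set is \<subseteq> nodes D \<and> \<sigma> b = wp is" if "pos b" for b
  proof -
    obtain "is" i where i: "set is \<subseteq> nodes D" "i \<in> nodes D" "b = wp is (\<alpha> i)"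
      using pos_root_conj_simple[of b] \<open>pos b\<close> by blast
    have "wp is \<circ> \<s> i \<circ> wp (rev is) = \<sigma> b \<circ> (wp is \<circ> wp (rev is))"
      using i by (simp add: wp_conj simple_root_root o_assoc)
    then have "\<sigma> b = wp (is @ i # rev is)" using i by (simp add: wp_append wp_o_wp_rev o_assoc)
    then show ?thesis using i by (intro exI[of _ "is @ i # rev is"]) auto
  qed
  from pos_or_neg[OF assms] show ?thesis
    using *[of b] *[of "- b"] reflection_uminus[OF assms] by auto
qed

lemma weyl_group_eq_parabolic: "W = WJ (nodes D)"
proof
  show "W \<subseteq> WJ (nodes D)"
  proof
    fix w assume "w \<in> W"
    then show "w \<in> WJ (nodes D)"
      unfolding weyl_group_def
    proof (rule generate_BijGroup_closed)
      show "id \<in> WJ (nodes D)"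
        unfolding parabolic_eq_words[OF order_refl] by (rule image_eqI[of _ _ "[]"]) auto
      show "s \<in> WJ (nodes D)" if "s \<in> \<sigma> ` roots D" for s
        using that reflection_word unfolding parabolic_eq_words[OF order_refl] by blast
      show "g \<circ> h \<in> WJ (nodes D)" if "g \<in> WJ (nodes D)" "h \<in> WJ (nodes D)" for g h
        using that unfolding parabolic_def
        by (rule generate_BijGroup_comp) (auto simp: reflection_o_reflection simple_root_root)
    qed (auto simp: reflection_o_reflection)
  qed
  show "WJ (nodes D) \<subseteq> W"
    unfolding weyl_group_def parabolic_def
    by (rule group.mono_generate[OF group_BijGroup]) (auto simp: simple_root_root)
qed

lemma weyl_group_eq_words: "W = wp ` {is. set is \<subseteq> nodes D}"
  by (simp add: weyl_group_eq_parabolic parabolic_eq_words)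

lemma in_weyl_groupE:
  assumes "w \<in> W"
  obtains "is" where "set is \<subseteq> nodes D" "w = wp is"
  using assms unfolding weyl_group_eq_words by blast

lemma wp_in_weyl_group [simp]: "set is \<subseteq> nodes D \<Longrightarrow> wp is \<in> W"
  unfolding weyl_group_eq_words by blast

lemma reflection_in_weyl_group: "b \<in> roots D \<Longrightarrow> \<sigma> b \<in> W"
  using reflection_word by (metis wp_in_weyl_group)

lemma parabolic_comp:
  assumes "J \<subseteq> nodes D" "g \<in> WJ J" "h \<in> WJ J"
  shows "g \<circ> h \<in> WJ J"
  using assms unfolding parabolic_def
  by (intro generate_BijGroup_comp) (auto simp: reflection_o_reflection simple_root_root)

lemma parabolic_inv:
  assumes J: "J \<subseteq> nodes D" and "g \<in> WJ J"
  shows "ginv g \<in> WJ J"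
proof -
  obtain "is" where "set is \<subseteq> J" "g = wp is" using assms unfolding parabolic_eq_words[OF J] by blast
  then show ?thesis using J unfolding parabolic_eq_words[OF J]
    by (intro image_eqI[of _ _ "rev is"]) (auto simp: inv_wp)
qed

lemma parabolic_id: "J \<subseteq> nodes D \<Longrightarrow> id \<in> WJ J"
  unfolding parabolic_eq_words by (rule image_eqI[of _ _ "[]"]) auto

lemma parabolic_subset: "J \<subseteq> nodes D \<Longrightarrow> WJ J \<subseteq> W"
  by (auto simp: parabolic_eq_words)

lemma weyl_comp: "g \<in> W \<Longrightarrow> h \<in> W \<Longrightarrow> g \<circ> h \<in> W"
  unfolding weyl_group_eq_parabolic by (rule parabolic_comp) auto

lemma weyl_inv: "g \<in> W \<Longrightarrow> ginv g \<in> W"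
  unfolding weyl_group_eq_parabolic by (rule parabolic_inv) auto

lemma weyl_bij: "g \<in> W \<Longrightarrow> bij g"
  by (metis in_weyl_groupE bij_wp)

lemma weyl_inv_left: "g \<in> W \<Longrightarrow> ginv g \<circ> g = id"
  by (simp add: weyl_bij bij_is_inj)

lemma weyl_inv_right: "g \<in> W \<Longrightarrow> g \<circ> ginv g = id"
  by (rule surj_iff[THEN iffD1, OF bij_is_surj[OF weyl_bij]])

lemma weyl_root: "w \<in> W \<Longrightarrow> b \<in> roots D \<Longrightarrow> w b \<in> roots D"
  by (metis in_weyl_groupE wp_root)

lemma weyl_uminus: "w \<in> W \<Longrightarrow> w (- x) = - w x"
  by (metis in_weyl_groupE additive.minus[OF additive_wp])

lemma weyl_conj: "w \<in> W \<Longrightarrow> b \<in> roots D \<Longrightarrow> w \<circ> \<sigma> b = \<sigma> (w b) \<circ> w"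
  by (metis in_weyl_groupE wp_conj)

section \<open>Length, reduced words and exchange\<close>

lemma len_wp_le: "set is \<subseteq> nodes D \<Longrightarrow> len (wp is) \<le> length is"
  unfolding weyl_length_def by (rule Least_le) blast

definition reduced :: "'i list \<Rightarrow> bool" where
  "reduced is \<longleftrightarrow> set is \<subseteq> nodes D \<and> len (wp is) = length is"

lemma reducedD: "reduced is \<Longrightarrow> set is \<subseteq> nodes D" "reduced is \<Longrightarrow> len (wp is) = length is"
  by (auto simp: reduced_def)

lemma exists_reduced_word:
  assumes "w \<in> W"
  obtains "is" where "reduced is" "w = wp is"
proof -
  let ?P = "\<lambda>n. \<exists>is. length is = n \<and> set is \<subseteq> nodes D \<and> w = wp is"
  obtain "is" where "set is \<subseteq> nodes D" "w = wp is" using assms by (rule in_weyl_groupE)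
  then have "?P (length is)" by blast
  then have "?P (len w)" unfolding weyl_length_def by (rule LeastI)
  then obtain js where "length js = len w" "set js \<subseteq> nodes D" "w = wp js" by blast
  then show ?thesis using that[of js] by (simp add: reduced_def)
qed

text \<open>The reflection is pushed through the word letter by letter, its root staying positive
  until it equals the simple root of the current letter, which it then cancels. This must happen,
  since the inverse of the whole word does not keep \<open>b\<close> positive.\<close>

lemma delete_letter:
  assumes "set is \<subseteq> nodes D" "pos b" "\<not> pos (wp (rev is) b)"
  shows "\<exists>xs i ys. is = xs @ i # ys \<and> \<sigma> b \<circ> wp is = wp (xs @ ys)"
  using assms
proof (induction "is" arbitrary: b)
  case (Cons i "is")
  then have i: "\<alpha> i \<in> roots D" by (simp add: simple_root_root)
  show ?case
  proof (cases "b = \<alpha> i")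
    case True
    then have "\<sigma> b \<circ> wp (i # is) = wp ([] @ is)"
      by (simp add: o_assoc reflection_o_reflection i)
    then show ?thesis by blast
  next
    case False
    then have "pos (\<s> i b)" using simple_reflection_pos Cons.prems by simp
    moreover have "\<not> pos (wp (rev is) (\<s> i b))" using Cons.prems by (simp add: wp_append)
    ultimately obtain xs k ys
      where k: "is = xs @ k # ys" "\<sigma> (\<s> i b) \<circ> wp is = wp (xs @ ys)"
      using Cons.IH[of "\<s> i b"] Cons.prems(1) by (metis insert_subset list.simps(15))
    have "\<s> i \<circ> \<sigma> (\<s> i b) = \<sigma> (\<s> i (\<s> i b)) \<circ> \<s> i"
      using reflection_conj[OF i] reflection_root[OF i] Cons.prems pos_root by blast
    then have "\<sigma> b \<circ> wp (i # is) = \<s> i \<circ> (\<sigma> (\<s> i b) \<circ> wp is)"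
      by (simp add: o_assoc reflection_reflection i)
    then have "\<sigma> b \<circ> wp (i # is) = wp ((i # xs) @ ys)" using k by simp
    moreover have "i # is = (i # xs) @ k # ys" using k by simp
    ultimately show ?thesis by blast
  qed
qed simp

lemma len_reflection_less:
  assumes "w \<in> W" "pos b" "\<not> pos (ginv w b)"
  shows "len (\<sigma> b \<circ> w) < len w"
proof -
  obtain "is" where w: "reduced is" "w = wp is" using assms(1) by (rule exists_reduced_word)
  then obtain xs i ys where "is = xs @ i # ys" "\<sigma> b \<circ> w = wp (xs @ ys)"
    using delete_letter[of "is" b] assms by (metis inv_wp reducedD(1))
  then show ?thesis using w len_wp_le[of "xs @ ys"] by (auto simp: reduced_def)
qed

text \<open>Multiplying by \<open>\<sigma> b\<close> changes the sign of the image of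
  \<open>b\<close> under the inverse, so \<open>len_reflection_less\<close> applies with
  \<open>\<sigma> b \<circ> w\<close> as the longer element.\<close>

lemma len_reflection_greater:
  assumes w: "w \<in> W" and b: "pos b" and "pos (ginv w b)"
  shows "len w < len (\<sigma> b \<circ> w)"
proof -
  have r: "b \<in> roots D" using b pos_root by blast
  have v: "\<sigma> b \<circ> w \<in> W" using weyl_comp reflection_in_weyl_group r w by blast
  have "ginv (\<sigma> b \<circ> w) = ginv w \<circ> \<sigma> b"
    using w r by (simp add: o_inv_distrib weyl_bij bij_reflection inv_unique_comp[of "\<sigma> b" "\<sigma> b"] reflection_o_reflection)
  then have "ginv (\<sigma> b \<circ> w) b = - ginv w b"
    using w by (simp add: reflection_self r weyl_uminus weyl_inv)
  then have "len (\<sigma> b \<circ> (\<sigma> b \<circ> w)) < len (\<sigma> b \<circ> w)"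
    using len_reflection_less[OF v b] not_pos_and_neg[OF assms(3)] by simp
  then show ?thesis by (simp add: o_assoc reflection_o_reflection r)
qed

lemma len_reflection_neq:
  assumes "w \<in> W" "b \<in> roots D"
  shows "len (\<sigma> b \<circ> w) \<noteq> len w"
proof -
  have "len (\<sigma> c \<circ> w) \<noteq> len w" if "pos c" for c
    using len_reflection_less len_reflection_greater assms(1) that by (metis less_irrefl)
  then show ?thesis using pos_or_neg[OF assms(2)] reflection_uminus[OF assms(2)] by metis
qed

text \<open>Of \<open>b\<close> and \<open>- b\<close> take the positive one. By
  \<open>len_reflection_greater\<close>, a drop in length means that the inverse of the word does
  not keep it positive, as \<open>delete_letter\<close> requires.\<close>

lemma strong_exchange:
  assumes "set is \<subseteq> nodes D" "b \<in> roots D" "len (\<sigma> b \<circ> wp is) < len (wp is)"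
  shows "\<exists>xs i ys. is = xs @ i # ys \<and> \<sigma> b \<circ> wp is = wp (xs @ ys)"
proof -
  have *: "\<exists>xs i ys. is = xs @ i # ys \<and> \<sigma> c \<circ> wp is = wp (xs @ ys)"
    if "pos c" "len (\<sigma> c \<circ> wp is) < len (wp is)" for c
  proof (rule delete_letter[OF assms(1) that(1)])
    show "\<not> pos (wp (rev is) c)"
      using len_reflection_greater[of "wp is" c] that assms(1) inv_wp by force
  qed
  then show ?thesis using pos_or_neg[OF assms(2)] reflection_uminus[OF assms(2)] assms(3) by metis
qed


section \<open>Bruhat order and subwords\<close>

lemma weyl_id: "id \<in> W"
  using wp_in_weyl_group[of "[]"] by simp

lemma weyl_inv_apply: "g \<in> W \<Longrightarrow> ginv g (g x) = x" "g \<in> W \<Longrightarrow> g (ginv g x) = x"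
  by (simp_all add: weyl_bij bij_is_inj bij_is_surj surj_f_inv_f)

lemma weyl_cancel_left: "g \<in> W \<Longrightarrow> g \<circ> x = g \<circ> y \<longleftrightarrow> x = y"
  by (metis (no_types, opaque_lifting) comp_assoc id_comp weyl_inv_left)

lemma weyl_cancel_right: "g \<in> W \<Longrightarrow> x \<circ> g = y \<circ> g \<longleftrightarrow> x = y"
  by (metis (no_types, opaque_lifting) comp_assoc comp_id weyl_inv_right)

lemma weyl_inv_comp: "g \<in> W \<Longrightarrow> h \<in> W \<Longrightarrow> ginv (g \<circ> h) = ginv h \<circ> ginv g"
  by (simp add: o_inv_distrib weyl_bij)

lemma weyl_inv_inv: "g \<in> W \<Longrightarrow> ginv (ginv g) = g"
  by (simp add: inv_inv_eq weyl_bij)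

lemma len_id [simp]: "len id = 0"
  using len_wp_le[of "[]"] by simp

lemma len_eq_0D: "w \<in> W \<Longrightarrow> len w = 0 \<Longrightarrow> w = id"
  by (erule exists_reduced_word) (simp add: reduced_def)

lemma len_comp_le: "g \<in> W \<Longrightarrow> h \<in> W \<Longrightarrow> len (g \<circ> h) \<le> len g + len h"
proof -
  assume "g \<in> W" "h \<in> W"
  then obtain xs ys where "reduced xs" "g = wp xs" "reduced ys" "h = wp ys"
    by (meson exists_reduced_word)
  then show ?thesis using len_wp_le[of "xs @ ys"] by (simp add: reduced_def wp_append)
qed

lemma len_inv: "w \<in> W \<Longrightarrow> len (ginv w) = len w"
proof -
  have *: "len (ginv w) \<le> len w" if w: "w \<in> W" for w
  proof -
    obtain "is" where "reduced is" "w = wp is" using w by (rule exists_reduced_word)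
    then show ?thesis using len_wp_le[of "rev is"] by (simp add: reduced_def inv_wp)
  qed
  assume "w \<in> W"
  then show ?thesis using *[of w] *[of "ginv w"] by (simp add: weyl_inv weyl_inv_inv)
qed

lemma simple_refl_in_weyl_group: "i \<in> nodes D \<Longrightarrow> \<s> i \<in> W"
  using wp_in_weyl_group[of "[i]"] by simp

lemma simple_refl_cancel: "i \<in> nodes D \<Longrightarrow> \<s> i \<circ> (\<s> i \<circ> w) = w"
  by (simp add: o_assoc reflection_o_reflection simple_root_root)

lemma len_le_Suc_simple:
  assumes "i \<in> nodes D" "w \<in> W"
  shows "len (\<s> i \<circ> w) \<le> Suc (len w)" "len w \<le> Suc (len (\<s> i \<circ> w))"
proof -
  have s: "len (\<s> i) \<le> 1" using len_wp_le[of "[i]"] assms by simp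
  have *: "len (\<s> i \<circ> w) \<le> Suc (len w)" if "w \<in> W" for w
    using len_comp_le[OF simple_refl_in_weyl_group[OF assms(1)] that] s by simp
  show "len (\<s> i \<circ> w) \<le> Suc (len w)" using * assms by blast
  show "len w \<le> Suc (len (\<s> i \<circ> w))"
    using *[of "\<s> i \<circ> w"] assms weyl_comp simple_refl_in_weyl_group
    by (simp only: simple_refl_cancel)
qed

lemma subseq_delete: "subseq (xs @ ys) (xs @ i # ys)"
  by (simp add: subseq_append' list_emb_Cons)

lemma subseq_set: "subseq xs ys \<Longrightarrow> set xs \<subseteq> set ys"
  by (metis notin_set_nthsI subseq_conv_nths subsetI)

text \<open>Letters are prepended one at a time to a reduced word; if one shortens the product,
  exchange cancels it against an older letter and both are dropped.\<close>

lemma exists_reduced_subseq: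
  assumes "set is \<subseteq> nodes D"
  obtains js where "subseq js is" "reduced js" "wp js = wp is"
proof -
  have "\<exists>js. subseq js is \<and> reduced js \<and> wp js = wp is"
    using assms
  proof (induction "is")
    case Nil
    then show ?case by (intro exI[of _ "[]"]) (simp add: reduced_def)
  next
    case (Cons i "is")
    then obtain js where js: "subseq js is" "reduced js" "wp js = wp is" by auto
    have i: "i \<in> nodes D" and w: "wp js \<in> W" using Cons.prems js(2) by (auto simp: reduced_def)
    show ?case
    proof (cases "len (wp js) < len (\<s> i \<circ> wp js)")
      case True
      then have "reduced (i # js)"
        using js(2) i len_wp_le[of "i # js"] by (auto simp: reduced_def)
      then show ?thesis using js by (intro exI[of _ "i # js"]) simp
    next
      case False
      then have "len (\<s> i \<circ> wp js) < len (wp js)"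
        using len_reflection_neq[OF w simple_root_root[OF i]] by simp
      from strong_exchange[OF reducedD(1)[OF js(2)] simple_root_root[OF i] this]
      obtain xs k ys where k: "js = xs @ k # ys" "\<s> i \<circ> wp js = wp (xs @ ys)" by blast
      \<comment> \<open>A simple reflection lowers the length by at most 1, so the word with one
        letter removed cannot be shortened further.\<close>
      have "length js \<le> Suc (len (wp (xs @ ys)))"
        using len_le_Suc_simple(2)[OF i w] js(2) k(2) by (simp add: reduced_def)
      then have "reduced (xs @ ys)"
        using js(2) k(1) len_wp_le[of "xs @ ys"] by (auto simp: reduced_def)
      moreover have "subseq (xs @ ys) (i # is)"
        using subseq_delete[of xs ys k] js(1) k(1) by (meson list_emb_Cons subseq_order.trans)
      ultimately show ?thesis using js k by (intro exI[of _ "xs @ ys"]) simp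
    qed
  qed
  then show ?thesis using that by blast
qed

section \<open>The Bruhat order and its description by subwords\<close>

abbreviation bruhat :: "('x \<Rightarrow> 'x) \<Rightarrow> ('x \<Rightarrow> 'x) \<Rightarrow> bool" (infix "\<preceq>" 50) where
  "u \<preceq> w \<equiv> bruhat_le D u w"

lemma bruhat_in_weyl_group: "u \<preceq> w \<Longrightarrow> u \<in> W" "u \<preceq> w \<Longrightarrow> w \<in> W"
  by (simp_all add: bruhat_le_def)

lemma bruhat_refl: "u \<in> W \<Longrightarrow> u \<preceq> u"
  by (simp add: bruhat_le_def)

lemma bruhat_trans: "u \<preceq> v \<Longrightarrow> v \<preceq> w \<Longrightarrow> u \<preceq> w"
  by (auto simp: bruhat_le_def)

lemma bruhat_reflection:
  "u \<in> W \<Longrightarrow> b \<in> roots D \<Longrightarrow> len u < len (\<sigma> b \<circ> u) \<Longrightarrow> u \<preceq> \<sigma> b \<circ> u"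
  unfolding bruhat_le_def bruhat_step_def
  by (auto intro: weyl_comp reflection_in_weyl_group)

text \<open>Turns the closure of \<open>bruhat_step\<close> into a descent from \<open>w\<close> by
  one reflection at a time, remembering that all elements on the way lie below
  \<open>w\<close>.\<close>

lemma bruhat_induct [consumes 1, case_names refl step]:
  assumes "u \<preceq> w" and refl: "w \<in> W \<Longrightarrow> P w"
    and step: "\<And>u b. u \<in> W \<Longrightarrow> b \<in> roots D \<Longrightarrow> len u < len (\<sigma> b \<circ> u) \<Longrightarrow>
      \<sigma> b \<circ> u \<preceq> w \<Longrightarrow> P (\<sigma> b \<circ> u) \<Longrightarrow> P u"
  shows "P u"
proof -
  have "(u, w) \<in> (bruhat_step D)\<^sup>*" and w: "w \<in> W" using assms(1) by (auto simp: bruhat_le_def)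
  then show ?thesis
  proof (induction rule: converse_rtrancl_induct)
    case base
    then show ?case using refl by blast
  next
    case (step u v)
    then obtain b where b: "u \<in> W" "b \<in> roots D" "len u < len (\<sigma> b \<circ> u)" "v = \<sigma> b \<circ> u"
      by (auto simp: bruhat_step_def)
    then have "v \<in> W" using weyl_comp reflection_in_weyl_group by blast
    then have "v \<preceq> w" using step(2) w by (simp add: bruhat_le_def)
    then show ?case using assms(3) b step.IH w by blast
  qed
qed

lemma bruhat_len: "u \<preceq> w \<Longrightarrow> u = w \<or> len u < len w"
proof (induction rule: bruhat_induct)
  case (step u b)
  then show ?case by (metis less_trans)
qed simp

lemma bruhat_antisym: "u \<preceq> w \<Longrightarrow> w \<preceq> u \<Longrightarrow> u = w"
  using bruhat_len[of u w] bruhat_len[of w u] by auto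

text \<open>Each descent by a reflection deletes one letter, by
  \<open>strong_exchange\<close>.\<close>

lemma bruhat_imp_subseq:
  assumes "u \<preceq> wp is" "set is \<subseteq> nodes D"
  shows "\<exists>js. subseq js is \<and> u = wp js"
  using assms(1)
proof (induction rule: bruhat_induct)
  case refl
  then show ?case by blast
next
  case (step u b)
  then obtain js where js: "subseq js is" "\<sigma> b \<circ> u = wp js" by blast
  then have "set js \<subseteq> nodes D" using subseq_set assms(2) by blast
  moreover have u: "\<sigma> b \<circ> wp js = u"
    using js(2) step.hyps(2) by (metis id_comp o_assoc reflection_o_reflection)
  ultimately obtain xs i ys where "js = xs @ i # ys" "u = wp (xs @ ys)"
    using strong_exchange[of js b] step.hyps js(2) by auto
  then show ?case using js(1) subseq_delete subseq_order.trans by metis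
qed

text \<open>This is the lifting property. If the reflection of a step is the simple one, the product
  is the next element of the chain. Otherwise the simple reflection keeps its root positive, so
  conjugating the step gives another ascending step.\<close>

lemma bruhat_simple_refl:
  assumes "u \<preceq> w" and i: "i \<in> nodes D"
  shows "\<s> i \<circ> u \<preceq> \<s> i \<circ> w \<or> \<s> i \<circ> u \<preceq> w"
  using assms(1)
proof (induction rule: bruhat_induct)
  case refl
  then show ?case using i by (blast intro: bruhat_refl weyl_comp simple_refl_in_weyl_group)
next
  case (step u b)
  have ar: "\<alpha> i \<in> roots D" using i by (rule simple_root_root)
  \<comment> \<open>\<open>b\<close> and \<open>- b\<close> define the same reflection, so a
    positive root may be chosen.\<close>
  have "\<exists>c. pos c \<and> \<sigma> c = \<sigma> b" using pos_or_neg reflection_uminus step.hyps(2) by metis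
  then obtain c where c: "pos c" "\<sigma> c = \<sigma> b" by blast
  have cr: "c \<in> roots D" using c(1) by (rule pos_root)
  have v: "\<sigma> c \<circ> u \<in> W" using step.hyps(1) cr weyl_comp reflection_in_weyl_group by blast
  have su: "\<s> i \<circ> u \<in> W" using step.hyps(1) i weyl_comp simple_refl_in_weyl_group by blast
  show ?case
  proof (cases "c = \<alpha> i")
    case True
    then show ?thesis using step.hyps(4) c(2) by metis
  next
    case False
    then have p: "pos (\<s> i c)" using simple_reflection_pos i c(1) by blast
    have eq: "\<sigma> (\<s> i c) \<circ> (\<s> i \<circ> u) = \<s> i \<circ> (\<sigma> c \<circ> u)"
      using reflection_conj[OF ar cr] by (metis o_assoc)
    have "pos (ginv u c)"
    proof (rule ccontr)
      assume "\<not> pos (ginv u c)"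
      then show False using len_reflection_less[OF step.hyps(1) c(1)] step.hyps(3) c(2) by simp
    qed
    moreover have "ginv (\<s> i \<circ> u) (\<s> i c) = ginv u c"
    proof -
      have "ginv (\<s> i \<circ> u) ((\<s> i \<circ> u) (ginv u c)) = ginv u c" by (rule weyl_inv_apply(1)[OF su])
      then show ?thesis using weyl_inv_apply(2)[OF step.hyps(1)] by simp
    qed
    ultimately have "len (\<s> i \<circ> u) < len (\<s> i \<circ> (\<sigma> c \<circ> u))"
      using len_reflection_greater[OF su p] eq by simp
    then have "\<s> i \<circ> u \<preceq> \<s> i \<circ> (\<sigma> c \<circ> u)"
      using bruhat_reflection[OF su pos_root[OF p]] eq by simp
    then show ?thesis using step.IH c(2) bruhat_trans by metis
  qed
qed

lemma reduced_ConsD: "reduced (i # is) \<Longrightarrow> reduced is"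
  using len_le_Suc_simple(1)[of i "wp is"] len_wp_le[of "is"] by (auto simp: reduced_def)

text \<open>Induction on the reduced word. When the subword keeps the first letter, both outcomes of
  \<open>bruhat_simple_refl\<close> lie below the full product, because prepending that letter
  ascends.\<close>

lemma subseq_imp_bruhat:
  assumes "reduced is" "subseq js is"
  shows "wp js \<preceq> wp is"
  using assms
proof (induction "is" arbitrary: js)
  case Nil
  then have "js = []" by simp
  then show ?case using bruhat_refl[OF weyl_id] by (simp only: wp_Nil)
next
  case (Cons i "is")
  have "reduced is" using Cons.prems(1) by (rule reduced_ConsD)
  then have i: "i \<in> nodes D" "wp is \<in> W" and less: "len (wp is) < len (\<s> i \<circ> wp is)"
    using Cons.prems(1) by (auto simp: reduced_def)
  have le: "wp is \<preceq> \<s> i \<circ> wp is"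
    using bruhat_reflection[OF i(2) simple_root_root[OF i(1)] less] .
  have nil: "wp [] \<preceq> \<s> i \<circ> wp is"
    using bruhat_trans[OF Cons.IH[OF \<open>reduced is\<close> list_emb_Nil] le] .
  from Cons.prems(2) show ?case
  proof (cases rule: list_emb.cases)
    case list_emb_Nil
    then show ?thesis using nil by (metis wp_Cons)
  next
    case list_emb_Cons
    then show ?thesis using Cons.IH[OF \<open>reduced is\<close>] le bruhat_trans by (metis list.inject wp_Cons)
  next
    case (list_emb_Cons2 _ ks)
    then have "wp ks \<preceq> wp is" using Cons.IH[OF \<open>reduced is\<close>] by simp
    from bruhat_simple_refl[OF this i(1)] show ?thesis
      using list_emb_Cons2 le bruhat_trans by (metis list.inject wp_Cons)
  qed
qed

text \<open>A subword of two concatenated reduced words splits into a subword of each.\<close>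

lemma bruhat_compE:
  assumes "u \<preceq> p \<circ> q" "p \<in> W" "q \<in> W"
  obtains p' q' where "p' \<preceq> p" "q' \<preceq> q" "u = p' \<circ> q'"
proof -
  obtain xs ys where w: "reduced xs" "p = wp xs" "reduced ys" "q = wp ys"
    using assms(2,3) by (meson exists_reduced_word)
  then obtain js where "subseq js (xs @ ys)" "u = wp js"
    using bruhat_imp_subseq[of u "xs @ ys"] assms(1) by (auto simp: wp_append reduced_def)
  then obtain xs' ys' where "u = wp xs' \<circ> wp ys'" "subseq xs' xs" "subseq ys' ys"
    by (metis subseq_appendE wp_append)
  then show ?thesis using that subseq_imp_bruhat w by blast
qed

text \<open>Additivity of length makes the concatenation of reduced words reduced, so concatenated
  subwords give smaller elements.\<close>

lemma bruhat_comp_mono: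
  assumes "p' \<preceq> p" "q' \<preceq> q" and len: "len (p \<circ> q) = len p + len q"
  shows "p' \<circ> q' \<preceq> p \<circ> q"
proof -
  obtain xs ys where w: "reduced xs" "p = wp xs" "reduced ys" "q = wp ys"
    using assms(1,2) by (meson exists_reduced_word bruhat_in_weyl_group)
  then obtain xs' ys' where s: "subseq xs' xs" "p' = wp xs'" "subseq ys' ys" "q' = wp ys'"
    using bruhat_imp_subseq[of p' xs] bruhat_imp_subseq[of q' ys] assms(1,2)
    by (auto simp: reduced_def)
  have "reduced (xs @ ys)" using w len by (simp add: reduced_def wp_append)
  moreover have "subseq (xs' @ ys') (xs @ ys)" using s by (simp add: list_emb_append_mono)
  ultimately show ?thesis using subseq_imp_bruhat w s by (metis wp_append)
qed

text \<open>Inversion turns a left multiplication by \<open>\<sigma> b\<close> into a right one;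
  moving the reflection back to the left replaces \<open>b\<close> by
  \<open>ginv u b\<close>.\<close>

lemma bruhat_inv:
  assumes "u \<preceq> w"
  shows "ginv u \<preceq> ginv w"
  using assms
proof (induction rule: bruhat_induct)
  case refl
  then show ?case by (simp add: bruhat_refl weyl_inv)
next
  case (step u b)
  let ?c = "ginv u b"
  have c: "?c \<in> roots D" and u: "ginv u \<in> W" and sb: "\<sigma> b \<in> W"
    using step.hyps weyl_inv weyl_root reflection_in_weyl_group by auto
  have eq: "ginv (\<sigma> b \<circ> u) = \<sigma> ?c \<circ> ginv u"
    using weyl_conj[OF u step.hyps(2)] step.hyps weyl_inv_comp[OF sb step.hyps(1)]
      inv_unique_comp[of "\<sigma> b" "\<sigma> b"] by (simp add: reflection_o_reflection)
  have "len (ginv u) < len (\<sigma> ?c \<circ> ginv u)"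
    using step.hyps(1,3) len_inv[OF weyl_comp[OF sb step.hyps(1)]] by (simp add: eq len_inv)
  then have "ginv u \<preceq> ginv (\<sigma> b \<circ> u)" using bruhat_reflection[OF u c] eq by simp
  then show ?case using step.IH bruhat_trans by blast
qed

lemma bruhat_inv_iff: "u \<in> W \<Longrightarrow> w \<in> W \<Longrightarrow> ginv u \<preceq> ginv w \<longleftrightarrow> u \<preceq> w"
  using bruhat_inv[of u w] bruhat_inv[of "ginv u" "ginv w"] by (auto simp: weyl_inv_inv)


section \<open>Parabolic cosets and longest elements\<close>

lemma parabolic_reduced_word:
  assumes J: "J \<subseteq> nodes D" and "x \<in> WJ J"
  obtains "is" where "reduced is" "set is \<subseteq> J" "x = wp is"
proof -
  obtain js where js: "set js \<subseteq> J" "x = wp js" using assms(2) parabolic_eq_words[OF J] by blast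
  then have "set js \<subseteq> nodes D" using J by blast
  then obtain ks where ks: "subseq ks js" "reduced ks" "wp ks = wp js"
    by (rule exists_reduced_subseq)
  show ?thesis
  proof (rule that)
    show "set ks \<subseteq> J" using subseq_set[OF ks(1)] js(1) by (rule order_trans)
    show "x = wp ks" using js(2) ks(3) by simp
  qed (rule ks(2))
qed

lemma parabolic_bruhat_closed:
  assumes J: "J \<subseteq> nodes D" and "u \<preceq> x" "x \<in> WJ J"
  shows "u \<in> WJ J"
proof -
  obtain "is" where "is": "set is \<subseteq> J" "x = wp is" using assms(3) parabolic_eq_words[OF J] by blast
  then obtain js where "subseq js is" "u = wp js"
    using bruhat_imp_subseq[of u "is"] assms(2) J by blast
  then show ?thesis using "is" subseq_set unfolding parabolic_eq_words[OF J] by blast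
qed

section \<open>Minimal coset representatives\<close>

lemma min_coset_reps_in_weyl_group: "w \<in> min_coset_reps D J \<Longrightarrow> w \<in> W"
  by (simp add: min_coset_reps_def)

text \<open>If the concatenation of reduced words of \<open>w\<close> and \<open>z\<close> were not reduced, deleting letters would
  shorten either the word of \<open>w\<close> to one of another element of its coset, or the word of \<open>z\<close>.\<close>

lemma len_min_coset_rep:
  assumes J: "J \<subseteq> nodes D" and w: "w \<in> min_coset_reps D J" and z: "z \<in> WJ J"
  shows "len (w \<circ> z) = len w + len z"
proof -
  have wW: "w \<in> W" using w by (rule min_coset_reps_in_weyl_group)
  obtain xs where xs: "reduced xs" "w = wp xs" using wW by (rule exists_reduced_word)
  obtain ys where ys: "reduced ys" "set ys \<subseteq> J" "z = wp ys" using parabolic_reduced_word[OF J z] .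
  have "set (xs @ ys) \<subseteq> nodes D" using xs ys by (simp add: reduced_def)
  then obtain zs where zs: "subseq zs (xs @ ys)" "reduced zs" "wp zs = wp (xs @ ys)"
    by (rule exists_reduced_subseq)
  then obtain xs' ys' where s: "zs = xs' @ ys'" "subseq xs' xs" "subseq ys' ys"
    by (meson subseq_appendE)
  have n: "set xs' \<subseteq> nodes D" "set ys' \<subseteq> nodes D" "set ys' \<subseteq> J"
    using s zs(2) ys(2) subseq_set by (auto simp: reduced_def)
  have "wp ys' \<in> WJ J" using n(3) unfolding parabolic_eq_words[OF J] by blast
  then have "z \<circ> ginv (wp ys') \<in> WJ J" using parabolic_comp[OF J z] parabolic_inv[OF J] by blast
  moreover have e: "w \<circ> z = wp xs' \<circ> wp ys'" using zs(3) s(1) xs ys by (simp add: wp_append)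
  then have "wp xs' = w \<circ> (z \<circ> ginv (wp ys'))"
    using weyl_inv_right[of "wp ys'"] n(2) by (metis comp_assoc comp_id wp_in_weyl_group)
  ultimately have "len w \<le> len (wp xs')" using w by (auto simp: min_coset_reps_def)
  then have "length xs \<le> length xs'" using xs len_wp_le[OF n(1)] by (simp add: reduced_def)
  then have x: "xs' = xs" using s(2) by (metis le_antisym list_emb_length subseq_same_length)
  then have "w \<circ> wp ys' = w \<circ> z" using e xs(2) by (simp only:)
  then have "wp ys' = z" by (rule weyl_cancel_left[OF wW, THEN iffD1])
  then have "length ys \<le> length ys'" using ys len_wp_le[OF n(2)] by (simp add: reduced_def)
  then show ?thesis using zs(2,3) s x xs ys list_emb_length[OF s(3)]
    by (simp add: reduced_def wp_append)
qed

text \<open>Each representative is the other one times an element of the parabolic subgroup.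
  Additivity of length then forces this element to have length 0.\<close>

lemma min_coset_rep_unique:
  assumes J: "J \<subseteq> nodes D" and w: "w \<in> min_coset_reps D J" "w' \<in> min_coset_reps D J"
    and z: "z \<in> WJ J" "z' \<in> WJ J" and eq: "w \<circ> z = w' \<circ> z'"
  shows "w = w' \<and> z = z'"
proof -
  have W: "w \<in> W" "w' \<in> W" "z \<in> W" "z' \<in> W"
    using w z parabolic_subset[OF J] min_coset_reps_in_weyl_group by auto
  let ?y = "z' \<circ> ginv z"
  have y: "?y \<in> WJ J" using z parabolic_comp[OF J] parabolic_inv[OF J] by blast
  have w1: "w = w' \<circ> ?y"
    using eq weyl_inv_right[OF W(3)] by (metis comp_assoc comp_id)
  have "w' = w \<circ> (z \<circ> ginv z')"
    using eq weyl_inv_right[OF W(4)] by (metis comp_assoc comp_id)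
  moreover have "z \<circ> ginv z' \<in> WJ J" using z parabolic_comp[OF J] parabolic_inv[OF J] by blast
  ultimately have "len w \<le> len w'" using len_min_coset_rep[OF J w(1)] by (metis le_add1)
  then have "len ?y = 0" using len_min_coset_rep[OF J w(2) y] w1 by simp
  then have "?y = id" using y len_eq_0D parabolic_subset[OF J] by blast
  then have "w = w'" using w1 by simp
  moreover from this have "z = z'" using eq weyl_cancel_left[OF W(2), of z z'] by (simp only:)
  ultimately show ?thesis ..
qed

lemma exists_min_coset_rep:
  assumes J: "J \<subseteq> nodes D" and x: "x \<in> W"
  obtains w z where "w \<in> min_coset_reps D J" "z \<in> WJ J" "x = w \<circ> z"
proof -
  define P where "P = (\<lambda>w. \<exists>z\<in>WJ J. w = x \<circ> z)"
  define z where "z = arg_min len P"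
  have "P x" unfolding P_def using parabolic_id[OF J] by (metis comp_id)
  then have z: "\<exists>y\<in>WJ J. z = x \<circ> y" and min: "\<And>y. y \<in> WJ J \<Longrightarrow> len z \<le> len (x \<circ> y)"
    using arg_min_nat_lemma[of P x len] unfolding P_def z_def by blast+
  then obtain y where y: "y \<in> WJ J" "z = x \<circ> y" by blast
  have yW: "y \<in> W" using y parabolic_subset[OF J] by blast
  have "len z \<le> len (z \<circ> y')" if "y' \<in> WJ J" for y'
    using min[OF parabolic_comp[OF J y(1) that]] y(2) by (simp add: o_assoc)
  then have "z \<in> min_coset_reps D J" using y(2) yW x weyl_comp by (simp add: min_coset_reps_def)
  moreover have "x = z \<circ> ginv y" using y(2) weyl_inv_right[OF yW] by (metis comp_assoc comp_id)
  ultimately show ?thesis using that parabolic_inv[OF J y(1)] by blast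
qed

text \<open>Forward, \<open>bruhat_compE\<close> splits the smaller element, and the factor below
  \<open>c\<close> stays in the parabolic subgroup, which yields \<open>z\<close>. Backward, the two
  inequalities multiply because lengths add in \<open>w \<circ> c\<close>.\<close>

lemma bruhat_coset_iff:
  assumes J: "J \<subseteq> nodes D" and w: "w \<in> min_coset_reps D J" and w': "w' \<in> W"
    and c: "c \<in> WJ J" "c' \<in> WJ J"
  shows "w' \<circ> c' \<preceq> w \<circ> c \<longleftrightarrow> (\<exists>z\<in>WJ J. w' \<circ> z \<preceq> w \<and> ginv z \<circ> c' \<preceq> c)"
proof
  have cW: "c \<in> W" "c' \<in> W" using c parabolic_subset[OF J] by auto
  have wW: "w \<in> W" using w by (rule min_coset_reps_in_weyl_group)
  {
    assume "w' \<circ> c' \<preceq> w \<circ> c"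
    then obtain p q where pq: "p \<preceq> w" "q \<preceq> c" "w' \<circ> c' = p \<circ> q"
      using bruhat_compE wW cW(1) by blast
    \<comment> \<open>Chosen so that \<open>w' \<circ> ?z\<close> is \<open>p\<close> and
      \<open>ginv ?z \<circ> c'\<close> is \<open>q\<close>.\<close>
    let ?z = "c' \<circ> ginv q"
    have q: "q \<in> WJ J" using parabolic_bruhat_closed[OF J pq(2) c(1)] .
    then have qW: "q \<in> W" using parabolic_subset[OF J] by blast
    have z: "?z \<in> WJ J" using parabolic_comp[OF J c(2) parabolic_inv[OF J q]] .
    have "w' \<circ> ?z = p" using pq(3) weyl_inv_right[OF qW] by (metis comp_assoc comp_id)
    moreover have "ginv ?z \<circ> c' = q"
      using weyl_inv_comp[OF cW(2) weyl_inv[OF qW]] weyl_inv_inv[OF qW] weyl_inv_left[OF cW(2)]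
      by (metis comp_assoc comp_id)
    ultimately show "\<exists>z\<in>WJ J. w' \<circ> z \<preceq> w \<and> ginv z \<circ> c' \<preceq> c" using pq z by auto
  }
  assume "\<exists>z\<in>WJ J. w' \<circ> z \<preceq> w \<and> ginv z \<circ> c' \<preceq> c"
  then obtain z where z: "z \<in> WJ J" "w' \<circ> z \<preceq> w" "ginv z \<circ> c' \<preceq> c" by blast
  have "(w' \<circ> z) \<circ> (ginv z \<circ> c') \<preceq> w \<circ> c"
    using bruhat_comp_mono[OF z(2,3) len_min_coset_rep[OF J w c(1)]] .
  moreover have "(w' \<circ> z) \<circ> (ginv z \<circ> c') = w' \<circ> c'"
    using z(1) parabolic_subset[OF J] weyl_inv_right by (metis comp_assoc comp_id subsetD)
  ultimately show "w' \<circ> c' \<preceq> w \<circ> c" by simp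
qed

text \<open>An element of the Weyl group that fixes all roots has length 0, so the Weyl group embeds
  into the maps from the finite set of roots to itself.\<close>

lemma weyl_fix_roots:
  assumes w: "w \<in> W" and fixes_roots: "\<And>b. b \<in> roots D \<Longrightarrow> w b = b"
  shows "w = id"
proof -
  obtain "is" where "is": "reduced is" "w = wp is" using w by (rule exists_reduced_word)
  show ?thesis
  proof (cases "is")
    case Nil
    then show ?thesis using "is" by simp
  next
    case (Cons i js)
    then have i: "i \<in> nodes D" "set js \<subseteq> nodes D" using "is" by (auto simp: reduced_def)
    have "ginv w (\<alpha> i) = \<alpha> i"
      using weyl_inv_apply(1)[OF w, of "\<alpha> i"] fixes_roots[OF simple_root_root[OF i(1)]] by simp
    then have "len w < len (\<s> i \<circ> w)"
      using len_reflection_greater[OF w pos_simple[OF i(1)]] pos_simple[OF i(1)] by simp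
    also have "\<s> i \<circ> w = wp js" using "is"(2) Cons simple_refl_cancel[OF i(1)] by simp
    finally have "len w \<le> length js" using len_wp_le[OF i(2)] by linarith
    moreover have "len w = Suc (length js)" using "is" Cons by (auto dest: reducedD(2))
    ultimately show ?thesis by simp
  qed
qed

lemma finite_weyl_group: "finite W"
proof (rule inj_on_finite)
  show "inj_on (\<lambda>w. restrict w (roots D)) W"
  proof (rule inj_onI)
    fix v w assume vw: "v \<in> W" "w \<in> W" "restrict v (roots D) = restrict w (roots D)"
    then have "v b = w b" if "b \<in> roots D" for b using that by (metis restrict_apply')
    then have "(ginv v \<circ> w) b = b" if "b \<in> roots D" for b
      using that weyl_inv_apply(1)[OF vw(1), of b] by simp
    then have "ginv v \<circ> w = id" using weyl_fix_roots vw weyl_comp weyl_inv by blast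
    then show "v = w" using weyl_inv_right[OF vw(1)] by (metis comp_assoc comp_id id_comp)
  qed
  show "(\<lambda>w. restrict w (roots D)) ` W \<subseteq> roots D \<rightarrow>\<^sub>E roots D"
    by (auto simp: weyl_root)
qed (simp add: finite_PiE finite_roots)

section \<open>Longest elements of parabolic subgroups\<close>

context
  fixes J :: "'i set" and m :: "'x \<Rightarrow> 'x"
  assumes J: "J \<subseteq> nodes D"
  defines "m \<equiv> longest_in D J"
begin

lemma longest_in_parabolic: "m \<in> WJ J"
  and len_le_longest: "x \<in> WJ J \<Longrightarrow> len x \<le> len m"
proof -
  have "finite (WJ J)" using finite_weyl_group parabolic_subset[OF J] finite_subset by blast
  \<comment> \<open>A bound on the lengths ensures that the maximum defining \<open>m\<close> is
    attained.\<close>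
  then have "\<forall>y. y \<in> WJ J \<longrightarrow> len y < Suc (Max (len ` WJ J))" by (simp add: le_imp_less_Suc)
  then show "m \<in> WJ J" "x \<in> WJ J \<Longrightarrow> len x \<le> len m"
    using arg_max_nat_lemma[of "\<lambda>x. x \<in> WJ J" id len] parabolic_id[OF J]
    unfolding m_def longest_in_def arg_max_on_def by blast+
qed

lemma longest_in_weyl_group: "m \<in> W"
  using longest_in_parabolic parabolic_subset[OF J] by blast

text \<open>In the induction step, the word of \<open>m\<close> made of \<open>is\<close> and a reduced word of \<open>wp (rev is) \<circ> m\<close>
  loses a letter under the reflection that inserts \<open>i\<close> between the two parts; as \<open>is @ [i]\<close> is
  reduced, the deleted letter lies in the second part.\<close>

lemma len_inv_comp_longest:
  assumes "reduced is" "set is \<subseteq> J"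
  shows "len (wp (rev is) \<circ> m) + length is = len m"
  using assms
proof (induction "is" rule: rev_induct)
  case (snoc i "is")
  let ?u = "wp is" and ?y = "wp (rev is) \<circ> m"
  have n: "i \<in> J" "i \<in> nodes D" "set is \<subseteq> nodes D" "set is \<subseteq> J" using snoc.prems J by auto
  have uW: "?u \<in> W" and yW: "?y \<in> W"
    using n longest_in_weyl_group by (auto intro: weyl_comp)
  have m: "m = ?u \<circ> ?y" using n(3) by (simp add: o_assoc wp_o_wp_rev)
  have "length is + 1 \<le> len (wp is) + len (\<s> i)"
    using len_comp_le[OF uW simple_refl_in_weyl_group[OF n(2)]] snoc.prems(1)
    by (simp add: reduced_def wp_append)
  then have red: "reduced is"
    using len_wp_le[of "[i]"] len_wp_le[OF n(3)] n(2,3) by (simp add: reduced_def)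
  then have IH: "len ?y + length is = len m" using snoc.IH n by blast
  let ?b = "?u (\<alpha> i)"
  have b: "?b \<in> roots D" using wp_root n simple_root_root by blast
  have conj: "\<sigma> ?b \<circ> ?u = ?u \<circ> \<s> i" using wp_conj[OF n(3) simple_root_root[OF n(2)]] by simp
  have bm: "\<sigma> ?b \<circ> m = ?u \<circ> (\<s> i \<circ> ?y)"
    by (subst m) (simp only: o_assoc conj)
  have "\<sigma> ?b \<circ> m = wp (is @ [i] @ rev is) \<circ> m"
    unfolding bm by (simp add: wp_append o_assoc)
  also have "\<dots> \<in> WJ J"
    using n longest_in_parabolic
    by (intro parabolic_comp[OF J]) (auto simp: parabolic_eq_words[OF J])
  \<comment> \<open>A reflection always changes the length, and \<open>m\<close> is longest, so the
    length drops.\<close>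
  finally have "len (\<sigma> ?b \<circ> m) < len m"
    using len_le_longest len_reflection_neq[OF longest_in_weyl_group b] by (simp add: order_less_le)
  moreover obtain ys where ys: "reduced ys" "?y = wp ys" using yW by (rule exists_reduced_word)
  have mw: "m = wp (is @ ys)" using m ys(2) by (simp add: wp_append)
  ultimately obtain xs k zs where k: "is @ ys = xs @ k # zs" "\<sigma> ?b \<circ> m = wp (xs @ zs)"
    using strong_exchange[of "is @ ys" ?b] b n(3) ys(1) by (auto simp: reduced_def)
  have "len (\<s> i \<circ> ?y) < len ?y"
  proof (cases "length xs < length is")
    case True
    then obtain ts where ts: "is = xs @ k # ts" "zs = ts @ ys"
      using k(1) by (auto simp: append_eq_append_conv2 append_eq_Cons_conv)
    have "wp (xs @ zs) = wp (xs @ ts) \<circ> ?y"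
      unfolding ts(2) ys(2) by (simp add: wp_append o_assoc)
    then have "?u \<circ> \<s> i \<circ> ?y = wp (xs @ ts) \<circ> ?y"
      using k(2) bm by (simp only: o_assoc)
    then have "?u \<circ> \<s> i = wp (xs @ ts)"
      using weyl_cancel_right[OF yW] by blast
    then have "wp (is @ [i]) = wp (xs @ ts)" by (simp add: wp_append)
    then show ?thesis
      using len_wp_le[of "xs @ ts"] snoc.prems(1) n(3) ts by (auto simp: reduced_def)
  next
    case False
    then obtain ts where ts: "xs = is @ ts" "ys = ts @ k # zs"
      using k(1) by (auto simp: append_eq_append_conv2 append_eq_Cons_conv)
    have "wp (xs @ zs) = ?u \<circ> wp (ts @ zs)"
      unfolding ts(1) by (simp add: wp_append o_assoc)
    then have "?u \<circ> (\<s> i \<circ> ?y) = ?u \<circ> wp (ts @ zs)"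
      using k(2) bm by (simp only:)
    then have "\<s> i \<circ> ?y = wp (ts @ zs)"
      using weyl_cancel_left[OF uW] by blast
    then show ?thesis using len_wp_le[of "ts @ zs"] ys ts by (auto simp: reduced_def)
  qed
  then have "len ?y = Suc (len (\<s> i \<circ> ?y))" using len_le_Suc_simple(2)[OF n(2) yW] by simp
  moreover have "wp (rev (is @ [i])) \<circ> m = \<s> i \<circ> ?y" by (simp add: o_assoc)
  ultimately have "Suc (len (wp (rev (is @ [i])) \<circ> m)) = len ?y" by (simp only:)
  then show ?case using IH by (metis add_Suc_shift length_append_singleton)
qed simp

lemma len_comp_longest:
  assumes "x \<in> WJ J"
  shows "len (x \<circ> m) + len x = len m"
proof -
  obtain "is" where "is": "reduced is" "set is \<subseteq> J" "ginv x = wp is"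
    using parabolic_reduced_word[OF J parabolic_inv[OF J assms]] .
  have x: "x \<in> W" using assms parabolic_subset[OF J] by blast
  have "x = wp (rev is)" using weyl_inv_inv[OF x] "is" by (simp add: inv_wp reduced_def)
  moreover have "len x = length is" using len_inv[OF x] "is" by (simp add: reduced_def)
  ultimately show ?thesis using len_inv_comp_longest "is" by simp
qed

text \<open>By the length formula, \<open>x \<circ> m\<close> has length 0. Taking \<open>m\<close>
  itself for \<open>x\<close> shows that \<open>m\<close> is an involution.\<close>

lemma longest_unique:
  assumes "x \<in> WJ J" "len x = len m"
  shows "x = ginv m"
proof -
  have "x \<circ> m = id"
    using len_comp_longest[OF assms(1)] assms(2) parabolic_subset[OF J]
      parabolic_comp[OF J assms(1) longest_in_parabolic] by (intro len_eq_0D) auto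
  then show ?thesis using weyl_inv_right[OF longest_in_weyl_group] by (metis comp_assoc comp_id id_comp)
qed

lemma longest_inv: "ginv m = m"
  using longest_unique[OF longest_in_parabolic] by simp

lemma longest_o_longest: "m \<circ> m = id"
  using weyl_inv_left[OF longest_in_weyl_group] longest_inv by simp

lemma longest_cancel: "x \<circ> m \<circ> m = x"
  by (simp add: o_assoc[symmetric] longest_o_longest)

text \<open>Right multiplication by \<open>m\<close> complements lengths in the subgroup, so every
  ascending step becomes a descending one by the same reflection.\<close>

lemma bruhat_comp_longest:
  assumes "x \<preceq> y" "y \<in> WJ J"
  shows "y \<circ> m \<preceq> x \<circ> m"
  using assms(1)
proof (induction rule: bruhat_induct)
  case refl
  then show ?case by (intro bruhat_refl weyl_comp longest_in_weyl_group)
next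
  case (step x b)
  let ?t = "\<sigma> b \<circ> x"
  have xJ: "x \<in> WJ J"
    using parabolic_bruhat_closed[OF J _ assms(2)] bruhat_trans[OF bruhat_reflection step.hyps(4)]
      step.hyps by blast
  have tJ: "?t \<in> WJ J" using parabolic_bruhat_closed[OF J step.hyps(4) assms(2)] .
  have e: "\<sigma> b \<circ> (?t \<circ> m) = x \<circ> m"
    by (simp only: o_assoc reflection_o_reflection[OF step.hyps(2)] id_comp)
  have "len (?t \<circ> m) < len (x \<circ> m)"
    using len_comp_longest[OF xJ] len_comp_longest[OF tJ] step.hyps(3) by linarith
  then have "?t \<circ> m \<preceq> x \<circ> m"
    using bruhat_reflection[of "?t \<circ> m" b] e step.hyps(2) tJ parabolic_subset[OF J]
      weyl_comp longest_in_weyl_group by auto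
  then show ?case using step.IH bruhat_trans by blast
qed

lemma bruhat_comp_longest_iff:
  assumes "x \<in> WJ J" "y \<in> WJ J"
  shows "y \<circ> m \<preceq> x \<circ> m \<longleftrightarrow> x \<preceq> y"
proof
  assume "y \<circ> m \<preceq> x \<circ> m"
  then show "x \<preceq> y"
    using bruhat_comp_longest[of "y \<circ> m" "x \<circ> m"] parabolic_comp[OF J assms(1) longest_in_parabolic]
    by (simp only: longest_cancel)
qed (rule bruhat_comp_longest[OF _ assms(2)])

end

end


section \<open>The isomorphism\<close>

context i_root_datum
begin

abbreviation J :: "'i set" where "J \<equiv> black D"
abbreviation wb :: "'x \<Rightarrow> 'x" where "wb \<equiv> w_black D"
abbreviation T :: "('x \<Rightarrow> 'x) \<Rightarrow> 'x \<Rightarrow> 'x" where "T \<equiv> tau_W D"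

lemma w0_eq_longest_in_nodes: "w0 D = longest_in D (nodes D)"
  by (simp add: longest_element_def longest_in_def weyl_group_eq_parabolic)

lemmas wb_in_parabolic = longest_in_parabolic[OF black_nodes]
lemmas wb_in_weyl_group = longest_in_weyl_group[OF black_nodes]
lemmas w0_in_weyl_group = longest_in_weyl_group[OF order_refl, folded w0_eq_longest_in_nodes]
lemmas wb_o_wb = longest_o_longest[OF black_nodes]
lemmas w0_o_w0 = longest_o_longest[OF order_refl, folded w0_eq_longest_in_nodes]

lemma wb_cancel: "wb \<circ> (wb \<circ> x) = x"
  by (simp add: o_assoc wb_o_wb)

lemma w0_cancel_right: "x \<circ> w0 D \<circ> w0 D = x"
  by (simp add: o_assoc[symmetric] w0_o_w0)

lemma bruhat_comp_w0_iff: "x \<in> W \<Longrightarrow> y \<in> W \<Longrightarrow> y \<circ> w0 D \<preceq> x \<circ> w0 D \<longleftrightarrow> x \<preceq> y"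
  using bruhat_comp_longest_iff[OF order_refl, folded w0_eq_longest_in_nodes]
  by (simp only: weyl_group_eq_parabolic)

section \<open>The diagram automorphism acting on the Weyl group\<close>

lemma diagram_X_o_diagram_X: "diagram_X D \<circ> diagram_X D = id"
  by (rule ext) (simp add: involutive_X)

lemma inv_diagram_X: "ginv (diagram_X D) = diagram_X D"
  by (rule inv_unique_comp) (simp_all add: diagram_X_o_diagram_X)

text \<open>The automorphism preserves the pairing and carries the coroot of \<open>b\<close> to
  that of the image of \<open>b\<close>.\<close>

lemma diagram_X_conj:
  assumes "b \<in> roots D"
  shows "diagram_X D \<circ> \<sigma> b = \<sigma> (diagram_X D b) \<circ> diagram_X D"
proof
  fix x
  have add: "additive (diagram_X D)"
    and pair: "pairing D (diagram_X D x) (coroot D (diagram_X D b)) = pairing D x (coroot D b)"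
    using automorphism assms by (auto simp: based_automorphism_def)
  show "(diagram_X D \<circ> \<sigma> b) x = (\<sigma> (diagram_X D b) \<circ> diagram_X D) x"
    by (simp add: reflection_def additive.diff[OF add] additive_zscale[OF add] pair)
qed

lemma diagram_X_simple: "i \<in> nodes D \<Longrightarrow> diagram_X D (\<alpha> i) = \<alpha> (tau D i)"
  using automorphism by (simp add: based_automorphism_def)

lemma tau_nodes: "i \<in> nodes D \<Longrightarrow> tau D i \<in> nodes D"
  using automorphism by (auto simp: based_automorphism_def dest: bij_betw_apply)

lemma tau_W_eq: "T w = diagram_X D \<circ> w \<circ> diagram_X D"
  by (simp add: tau_W_def inv_diagram_X)

lemma tau_W_id: "T id = id"
  by (simp add: tau_W_eq diagram_X_o_diagram_X)

lemma tau_W_comp: "T (g \<circ> h) = T g \<circ> T h"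
  by (rule ext) (simp add: tau_W_eq involutive_X)

lemma tau_W_tau_W: "T (T w) = w"
  by (rule ext) (simp add: tau_W_eq involutive_X)

lemma tau_W_reflection: "b \<in> roots D \<Longrightarrow> T (\<sigma> b) = \<sigma> (diagram_X D b)"
  by (simp add: tau_W_eq diagram_X_conj o_assoc[symmetric] diagram_X_o_diagram_X)

lemma tau_W_wp: "set is \<subseteq> nodes D \<Longrightarrow> T (wp is) = wp (map (tau D) is)"
proof (induction "is")
  case (Cons i "is")
  then have "T (\<s> i) = \<s> (tau D i)"
    by (simp add: tau_W_reflection simple_root_root diagram_X_simple)
  moreover have "T (wp is) = wp (map (tau D) is)" by (rule Cons.IH) (use Cons.prems in simp)
  ultimately show ?case by (simp only: wp_Cons list.map tau_W_comp)
qed (simp add: tau_W_id)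

lemma tau_W_weyl: "w \<in> W \<Longrightarrow> T w \<in> W"
proof (erule in_weyl_groupE)
  fix "is" assume "set is \<subseteq> nodes D" "w = wp is"
  moreover from this have "set (map (tau D) is) \<subseteq> nodes D" using tau_nodes by auto
  ultimately show "T w \<in> W" by (simp add: tau_W_wp)
qed

lemma tau_W_parabolic: "w \<in> WJ J \<Longrightarrow> T w \<in> WJ J"
proof -
  assume "w \<in> WJ J"
  then obtain "is" where i: "set is \<subseteq> J" "w = wp is"
    using parabolic_eq_words[OF black_nodes] by blast
  then have "T w = wp (map (tau D) is)" using black_nodes by (simp add: tau_W_wp)
  moreover have "set (map (tau D) is) \<subseteq> J" using i tau_black by auto
  ultimately show ?thesis unfolding parabolic_eq_words[OF black_nodes] by blast
qed

text \<open>Relabelling the letters of a word keeps its number of letters, and \<open>T\<close> is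
  its own inverse.\<close>

lemma len_tau_W: "w \<in> W \<Longrightarrow> len (T w) = len w"
proof -
  have *: "len (T w) \<le> len w" if w: "w \<in> W" for w
  proof -
    obtain "is" where i: "reduced is" "w = wp is" using w by (rule exists_reduced_word)
    then show ?thesis
      using len_wp_le[of "map (tau D) is"] tau_nodes by (auto simp: reduced_def tau_W_wp)
  qed
  assume "w \<in> W"
  then show ?thesis using *[of w] *[of "T w"] by (simp add: tau_W_weyl tau_W_tau_W)
qed

lemma inv_tau_W: "w \<in> W \<Longrightarrow> ginv (T w) = T (ginv w)"
  by (rule inv_unique_comp)
    (simp_all add: tau_W_comp[symmetric] weyl_inv_left weyl_inv_right tau_W_id)

lemma bruhat_tau_W:
  assumes "u \<preceq> w"
  shows "T u \<preceq> T w"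
  using assms
proof (induction rule: bruhat_induct)
  case refl
  then show ?case by (rule bruhat_refl[OF tau_W_weyl])
next
  case (step u b)
  have d: "diagram_X D b \<in> roots D" using automorphism step.hyps(2) by (auto simp: based_automorphism_def)
  have eq: "T (\<sigma> b \<circ> u) = \<sigma> (diagram_X D b) \<circ> T u"
    using step.hyps(2) by (simp add: tau_W_comp tau_W_reflection)
  have "\<sigma> b \<circ> u \<in> W" using step.hyps weyl_comp reflection_in_weyl_group by blast
  then have "len (T u) < len (\<sigma> (diagram_X D b) \<circ> T u)"
    using step.hyps by (metis eq len_tau_W)
  then have "T u \<preceq> T (\<sigma> b \<circ> u)"
    unfolding eq by (rule bruhat_reflection[OF tau_W_weyl[OF step.hyps(1)] d])
  then show ?case using step.IH by (rule bruhat_trans)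
qed

lemma bruhat_tau_W_iff: "T u \<preceq> T w \<longleftrightarrow> u \<preceq> w"
  using bruhat_tau_W[of u w] bruhat_tau_W[of "T u" "T w"] by (auto simp: tau_W_tau_W)

text \<open>\<open>T\<close> preserves the black parabolic subgroup and the length, and the longest
  element there is unique.\<close>

lemma tau_W_wb: "T wb = wb"
  using longest_unique[OF black_nodes tau_W_parabolic[OF wb_in_parabolic]]
  by (simp add: len_tau_W wb_in_weyl_group longest_inv[OF black_nodes])

text \<open>Equates the two values prescribed for \<open>theta\<close> on a black simple
  root.\<close>

lemma wb_simple:
  assumes "i \<in> J"
  shows "wb (\<alpha> (tau D i)) = - \<alpha> i"
  using theta_simple_root[of i] theta_black[OF assms] assms black_nodes by (metis minus_minus subsetD)

text \<open>That \<open>\<theta>\<close> fixes the black simple roots means that it acts trivially on the black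
  parabolic subgroup.\<close>

lemma wb_tau_W:
  assumes "v \<in> WJ J"
  shows "wb \<circ> T v = v \<circ> wb"
proof -
  have "wb \<circ> T (wp is) = wp is \<circ> wb" if "set is \<subseteq> J" for "is"
    using that
  proof (induction "is")
    case (Cons i "is")
    have i: "i \<in> J" "i \<in> nodes D" using Cons.prems black_nodes by auto
    have "wb \<circ> T (\<s> i) = wb \<circ> \<s> (tau D i)"
      using i by (simp add: tau_W_reflection simple_root_root diagram_X_simple)
    also have "\<dots> = \<sigma> (- \<alpha> i) \<circ> wb"
      using weyl_conj[OF wb_in_weyl_group simple_root_root[OF tau_nodes[OF i(2)]]] wb_simple[OF i(1)]
      by simp
    also have "\<dots> = \<s> i \<circ> wb" by (simp add: reflection_uminus simple_root_root i)
    finally have s: "wb \<circ> T (\<s> i) = \<s> i \<circ> wb" .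
    have "wb \<circ> T (wp (i # is)) = (wb \<circ> T (\<s> i)) \<circ> T (wp is)"
      by (simp only: wp_Cons tau_W_comp o_assoc)
    also have "\<dots> = \<s> i \<circ> (wb \<circ> T (wp is))" by (simp only: s o_assoc)
    also have "wb \<circ> T (wp is) = wp is \<circ> wb" by (rule Cons.IH) (use Cons.prems in simp)
    finally show ?case by (simp only: wp_Cons o_assoc)
  qed (simp add: tau_W_id)
  then show ?thesis using assms unfolding parabolic_eq_words[OF black_nodes] by blast
qed

section \<open>The order-reversing bijection of the Weyl group\<close>

definition flip :: "('x \<Rightarrow> 'x) \<Rightarrow> 'x \<Rightarrow> 'x" where
  "flip y = ginv (T y) \<circ> w0 D"

lemma flip_weyl: "y \<in> W \<Longrightarrow> flip y \<in> W"
  unfolding flip_def by (intro weyl_comp weyl_inv tau_W_weyl w0_in_weyl_group)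

text \<open>\<open>T\<close> and inversion preserve the order, and right multiplication by
  \<open>w0 D\<close> reverses it.\<close>

lemma bruhat_flip_iff: "x \<in> W \<Longrightarrow> y \<in> W \<Longrightarrow> flip y \<preceq> flip x \<longleftrightarrow> x \<preceq> y"
  unfolding flip_def
  by (simp add: bruhat_comp_w0_iff weyl_inv tau_W_weyl bruhat_inv_iff bruhat_tau_W_iff)

lemma flip_inj: "x \<in> W \<Longrightarrow> y \<in> W \<Longrightarrow> flip x = flip y \<Longrightarrow> x = y"
  using bruhat_flip_iff[of x y] bruhat_flip_iff[of y x] bruhat_refl[OF flip_weyl]
  by (metis bruhat_antisym)

lemma flip_surj:
  assumes "u \<in> W"
  obtains y where "y \<in> W" "u = flip y"
proof
  \<comment> \<open>The equation \<open>ginv (T y) \<circ> w0 D = u\<close> is solved for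
    \<open>y\<close>, using that \<open>w0 D\<close> and \<open>T\<close> are involutive.\<close>
  let ?x = "u \<circ> w0 D"
  have x: "?x \<in> W" using assms weyl_comp w0_in_weyl_group by blast
  then show "T (ginv ?x) \<in> W" by (intro tau_W_weyl weyl_inv)
  show "u = flip (T (ginv ?x))"
    unfolding flip_def tau_W_tau_W by (simp only: weyl_inv_inv[OF x] w0_cancel_right)
qed

lemma flip_wb: "flip wb = w0 D \<circ> wb"
  by (simp add: flip_def tau_W_wb longest_inv[OF black_nodes] longest_commute)

lemma Q_set_flip_iff: "y \<in> W \<Longrightarrow> flip y \<in> Q_set D \<longleftrightarrow> wb \<preceq> y"
  using bruhat_flip_iff[OF wb_in_weyl_group] by (simp add: Q_set_def flip_weyl flip_wb)

section \<open>Factorisation along cosets of the black parabolic subgroup\<close>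

definition twist :: "('x \<Rightarrow> 'x) \<times> ('x \<Rightarrow> 'x) \<Rightarrow> 'x \<Rightarrow> 'x" where
  "twist = (\<lambda>(v, w). w \<circ> (ginv v \<circ> wb))"

lemma inv_comp_wb_parabolic: "v \<in> WJ J \<Longrightarrow> ginv v \<circ> wb \<in> WJ J"
  by (intro parabolic_comp[OF black_nodes] parabolic_inv[OF black_nodes] wb_in_parabolic)

lemma parabolic_weyl: "v \<in> WJ J \<Longrightarrow> v \<in> W"
  using parabolic_subset[OF black_nodes] by blast

lemma twist_weyl:
  assumes "v \<in> WJ J" "w \<in> W"
  shows "twist (v, w) \<in> W"
  using weyl_comp[OF assms(2) parabolic_weyl[OF inv_comp_wb_parabolic[OF assms(1)]]]
  by (simp add: twist_def)

text \<open>As \<open>w0 D\<close> and \<open>wb\<close> commute, the \<open>wb\<close> in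
  \<open>w_upper D\<close> can be moved next to the one closing \<open>theta_W D\<close>, and the
  two cancel.\<close>

lemma phi_eq:
  assumes w: "w \<in> W"
  shows "phi D (v, w) = v \<circ> wb \<circ> T (ginv w) \<circ> w0 D"
proof -
  have "phi D (v, w) = v \<circ> (wb \<circ> T (ginv w) \<circ> wb) \<circ> (wb \<circ> w0 D)"
    by (simp only: phi_def theta_W_def w_upper_def longest_commute longest_inv[OF black_nodes] split)
  also have "\<dots> = v \<circ> wb \<circ> T (ginv w) \<circ> (wb \<circ> (wb \<circ> w0 D))"
    by (simp only: o_assoc)
  finally show ?thesis by (simp only: wb_cancel)
qed

lemma phi_eq_flip:
  assumes v: "v \<in> WJ J" and w: "w \<in> W"
  shows "phi D (v, w) = flip (twist (v, w))"
proof -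
  have vW: "v \<in> W" using v by (rule parabolic_weyl)
  \<comment> \<open>\<open>wb_tau_W\<close> for \<open>ginv v\<close> moves \<open>wb\<close> to the
    left of it, at the price of a \<open>T\<close>. Everything then lies under one \<open>T\<close>,
    which cancels the one in \<open>flip\<close>.\<close>
  have "twist (v, w) = T (T w \<circ> (wb \<circ> ginv v))"
    using wb_tau_W[OF parabolic_inv[OF black_nodes v]]
    by (simp add: twist_def tau_W_comp tau_W_tau_W tau_W_wb)
  then have "flip (twist (v, w)) = ginv (T w \<circ> (wb \<circ> ginv v)) \<circ> w0 D"
    by (simp only: flip_def tau_W_tau_W)
  also have "ginv (T w \<circ> (wb \<circ> ginv v)) = v \<circ> wb \<circ> T (ginv w)"
    using vW w wb_in_weyl_group
    by (simp add: weyl_inv_comp weyl_comp weyl_inv tau_W_weyl weyl_inv_inv inv_tau_W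
        longest_inv[OF black_nodes])
  finally show ?thesis using phi_eq[OF w, of v] by (simp only:)
qed

lemma inv_comp_wb_le_iff:
  assumes "x \<in> WJ J" "y \<in> WJ J"
  shows "ginv y \<circ> wb \<preceq> ginv x \<circ> wb \<longleftrightarrow> x \<preceq> y"
  using bruhat_comp_longest_iff[OF black_nodes parabolic_inv[OF black_nodes assms(1)]
      parabolic_inv[OF black_nodes assms(2)]]
  by (simp add: bruhat_inv_iff parabolic_weyl assms)

text \<open>The coset criterion with parabolic factors of the form \<open>ginv v \<circ> wb\<close>:
  multiplying by \<open>ginv z\<close> replaces \<open>v'\<close> by \<open>v' \<circ> z\<close>,
  and \<open>inv_comp_wb_le_iff\<close> reverses the resulting inequality.\<close>

lemma twist_le_iff:
  assumes v: "v \<in> WJ J" "v' \<in> WJ J" and w: "w \<in> min_coset_reps D J" and w': "w' \<in> W"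
  shows "twist (v', w') \<preceq> twist (v, w) \<longleftrightarrow> (\<exists>z\<in>WJ J. w' \<circ> z \<preceq> w \<and> v \<preceq> v' \<circ> z)"
proof -
  have "ginv z \<circ> (ginv v' \<circ> wb) \<preceq> ginv v \<circ> wb \<longleftrightarrow> v \<preceq> v' \<circ> z" if z: "z \<in> WJ J" for z
  proof -
    have "ginv z \<circ> (ginv v' \<circ> wb) = ginv (v' \<circ> z) \<circ> wb"
      using z v by (simp add: weyl_inv_comp parabolic_weyl o_assoc)
    then show ?thesis
      using inv_comp_wb_le_iff[OF v(1) parabolic_comp[OF black_nodes v(2) z]] by (simp only:)
  qed
  then show ?thesis
    using bruhat_coset_iff[OF black_nodes w w' inv_comp_wb_parabolic[OF v(1)]
        inv_comp_wb_parabolic[OF v(2)]]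
    by (auto simp: twist_def)
qed

text \<open>As \<open>wb\<close> is the twist of \<open>(id, id)\<close>, the criterion asks for
  some \<open>z\<close> between \<open>v\<close> and \<open>w\<close>; \<open>v\<close> itself
  serves.\<close>

lemma wb_le_twist_iff:
  assumes v: "v \<in> WJ J" and w: "w \<in> min_coset_reps D J"
  shows "wb \<preceq> twist (v, w) \<longleftrightarrow> v \<preceq> w"
proof -
  have "wb = twist (id, id)" by (simp add: twist_def)
  then have "wb \<preceq> twist (v, w) \<longleftrightarrow> (\<exists>z\<in>WJ J. z \<preceq> w \<and> v \<preceq> z)"
    using twist_le_iff[OF v parabolic_id[OF black_nodes] w weyl_id] by simp
  also have "\<dots> \<longleftrightarrow> v \<preceq> w"
    using v bruhat_trans bruhat_refl parabolic_weyl by blast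
  finally show ?thesis .
qed

section \<open>Comparison of the two posets\<close>

lemma P_setD:
  assumes "(v, w) \<in> P_set D"
  shows "v \<in> WJ J" "w \<in> min_coset_reps D J" "v \<preceq> w" "w \<in> W"
  using assms min_coset_reps_in_weyl_group by (auto simp: P_set_def)

text \<open>The middle relation of \<open>P_order\<close> comes from multiplying
  \<open>v' \<preceq> w'\<close> by \<open>z\<close>; lengths add there because \<open>w'\<close> is
  a minimal representative.\<close>

lemma P_order_iff:
  assumes p: "(v', w') \<in> P_set D" "(v, w) \<in> P_set D"
  shows "((v', w'), (v, w)) \<in> P_order D \<longleftrightarrow> twist (v', w') \<preceq> twist (v, w)"
proof -
  note d = P_setD[OF p(1)] P_setD[OF p(2)]
  have "v' \<circ> z \<preceq> w' \<circ> z" if z: "z \<in> WJ J" for z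
    using bruhat_comp_mono[OF d(3) bruhat_refl[OF parabolic_weyl[OF z]]
        len_min_coset_rep[OF black_nodes d(2) z]] .
  then show ?thesis
    unfolding twist_le_iff[OF d(5) d(1) d(6) d(4)] using p by (auto simp: P_order_def)
qed

lemma twist_inj:
  assumes p: "(v, w) \<in> P_set D" "(v', w') \<in> P_set D" and eq: "twist (v, w) = twist (v', w')"
  shows "(v, w) = (v', w')"
proof -
  note d = P_setD[OF p(1)] P_setD[OF p(2)]
  have "w = w'" "ginv v \<circ> wb = ginv v' \<circ> wb"
    using min_coset_rep_unique[OF black_nodes d(2) d(6) inv_comp_wb_parabolic[OF d(1)]
        inv_comp_wb_parabolic[OF d(5)]] eq by (simp_all add: twist_def)
  then have "ginv v = ginv v'" using weyl_cancel_right[OF wb_in_weyl_group] by blast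
  then have "v = v'" using weyl_inv_inv d parabolic_weyl by metis
  then show ?thesis using \<open>w = w'\<close> by simp
qed

lemma twist_surj:
  assumes y: "wb \<preceq> y"
  obtains v w where "(v, w) \<in> P_set D" "y = twist (v, w)"
proof -
  obtain w z where wz: "w \<in> min_coset_reps D J" "z \<in> WJ J" "y = w \<circ> z"
    using exists_min_coset_rep[OF black_nodes bruhat_in_weyl_group(2)[OF y]] .
  \<comment> \<open>The solution of \<open>ginv ?v \<circ> wb = z\<close>.\<close>
  let ?v = "wb \<circ> ginv z"
  have v: "?v \<in> WJ J"
    using wz by (intro parabolic_comp[OF black_nodes] parabolic_inv[OF black_nodes] wb_in_parabolic)
  have zW: "z \<in> W" using wz(2) by (rule parabolic_weyl)
  have "ginv ?v = z \<circ> wb"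
    using zW by (simp add: weyl_inv_comp wb_in_weyl_group weyl_inv weyl_inv_inv longest_inv[OF black_nodes])
  then have t: "y = twist (?v, w)"
    using longest_cancel[OF black_nodes, of z] by (simp only: twist_def split wz(3))
  then have "?v \<preceq> w" using y wb_le_twist_iff[OF v wz(1)] by simp
  then show ?thesis using that[OF _ t] v wz(1) by (simp add: P_set_def)
qed

lemma bij_betw_phi: "bij_betw (phi D) (P_set D) (Q_set D)"
proof (rule bij_betwI')
  fix p p' assume "p \<in> P_set D" "p' \<in> P_set D"
  then obtain v w v' w' where p: "p = (v, w)" "p' = (v', w')" "(v, w) \<in> P_set D" "(v', w') \<in> P_set D"
    by (metis prod.exhaust)
  note d = P_setD[OF p(3)] P_setD[OF p(4)]
  show "phi D p = phi D p' \<longleftrightarrow> p = p'"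
    using twist_inj[OF p(3,4)] flip_inj[OF twist_weyl[OF d(1,4)] twist_weyl[OF d(5,8)]]
      phi_eq_flip[OF d(1,4)] phi_eq_flip[OF d(5,8)] unfolding p(1,2) by metis
next
  fix p assume "p \<in> P_set D"
  then obtain v w where p: "p = (v, w)" "(v, w) \<in> P_set D" by (metis prod.exhaust)
  note d = P_setD[OF p(2)]
  show "phi D p \<in> Q_set D"
    unfolding p(1) phi_eq_flip[OF d(1,4)] Q_set_flip_iff[OF twist_weyl[OF d(1,4)]]
      wb_le_twist_iff[OF d(1,2)] by (rule d(3))
next
  fix u assume u: "u \<in> Q_set D"
  then have "u \<in> W" by (simp add: Q_set_def)
  then obtain y where y: "y \<in> W" "u = flip y" by (rule flip_surj)
  then have "wb \<preceq> y" using u Q_set_flip_iff by simp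
  then obtain v w where vw: "(v, w) \<in> P_set D" "y = twist (v, w)" by (rule twist_surj)
  then show "\<exists>p\<in>P_set D. u = phi D p"
    using y(2) phi_eq_flip[OF P_setD(1,4)[OF vw(1)]] by metis
qed

lemma phi_order_iff:
  assumes "p \<in> P_set D" "p' \<in> P_set D"
  shows "(p, p') \<in> P_order D \<longleftrightarrow> (phi D p, phi D p') \<in> (Q_order D)\<inverse>"
proof -
  obtain v w v' w' where p: "p = (v, w)" "p' = (v', w')" "(v, w) \<in> P_set D" "(v', w') \<in> P_set D"
    using assms by (metis prod.exhaust)
  note d = P_setD[OF p(3)] P_setD[OF p(4)]
  have "phi D p \<in> Q_set D" "phi D p' \<in> Q_set D"
    using bij_betw_phi assms by (auto dest: bij_betw_apply)
  moreover have "phi D p' \<preceq> phi D p \<longleftrightarrow> twist p \<preceq> twist p'"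
    unfolding p(1,2) phi_eq_flip[OF d(1,4)] phi_eq_flip[OF d(5,8)]
    by (rule bruhat_flip_iff[OF twist_weyl[OF d(1,4)] twist_weyl[OF d(5,8)]])
  ultimately show ?thesis
    using P_order_iff[OF p(3,4)] unfolding p(1,2) by (simp add: Q_order_def)
qed

lemma partial_order_on_Q: "partial_order_on (Q_set D) (Q_order D)"
  unfolding partial_order_on_def preorder_on_def
proof (intro conjI)
  show "refl_on (Q_set D) (Q_order D)"
    by (auto simp: refl_on_def Q_order_def Q_set_def bruhat_refl)
  show "trans (Q_order D)"
    by (rule transI) (auto simp: Q_order_def intro: bruhat_trans)
  show "antisym (Q_order D)"
    by (rule antisymI) (auto simp: Q_order_def intro: bruhat_antisym)
  show "Q_order D \<subseteq> Q_set D \<times> Q_set D" by (auto simp: Q_order_def)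
qed

end

text \<open>Transfers the order axioms from the Bruhat order to \<open>P_order\<close>, avoiding a
  composition of the witnesses \<open>z\<close>. Antisymmetry rests on the injectivity of
  \<open>f\<close>.\<close>

lemma partial_order_on_pullback:
  assumes s: "partial_order_on B s" and f: "f ` A \<subseteq> B" "inj_on f A" and r: "r \<subseteq> A \<times> A"
    and iff: "\<And>a a'. a \<in> A \<Longrightarrow> a' \<in> A \<Longrightarrow> (a, a') \<in> r \<longleftrightarrow> (f a, f a') \<in> s"
  shows "partial_order_on A r"
  unfolding partial_order_on_def preorder_on_def
proof (intro conjI)
  note s = partial_order_onD[OF s]
  show "refl_on A r" using s(1) f(1) iff by (auto simp: refl_on_def)
  show "trans r"
  proof (rule transI)
    fix a b c assume "(a, b) \<in> r" "(b, c) \<in> r"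
    moreover from this have "a \<in> A" "b \<in> A" "c \<in> A" using r by auto
    ultimately show "(a, c) \<in> r" using iff s(2) by (meson transD)
  qed
  show "antisym r"
  proof (rule antisymI)
    fix a b assume "(a, b) \<in> r" "(b, a) \<in> r"
    moreover from this have "a \<in> A" "b \<in> A" using r by auto
    ultimately show "a = b" using iff s(3) f(2) by (meson antisymD inj_onD)
  qed
qed (rule r)

theorem proposition3p2:
  fixes D :: "('x::ab_group_add, 'y::ab_group_add, 'i) i_root_datum"
  assumes "i_root_datum D"
  shows "poset_iso (P_set D) (P_order D) (Q_set D) ((Q_order D)\<inverse>) (phi D) \<and>
    (\<forall>(v, w)\<in>P_set D.
      phi D (v, w) = v \<circ> w_black D \<circ> tau_W D (inv_into UNIV w) \<circ> w0 D \<and>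
      phi D (v, w) = w_black D \<circ> tau_W D v \<circ> tau_W D (inv_into UNIV w) \<circ> w0 D)"
proof -
  interpret i_root_datum D by (fact assms)
  have Q: "partial_order_on (Q_set D) ((Q_order D)\<inverse>)" using partial_order_on_Q by simp
  have "partial_order_on (P_set D) (P_order D)"
  proof (rule partial_order_on_pullback[OF Q])
    show "phi D ` P_set D \<subseteq> Q_set D" "inj_on (phi D) (P_set D)"
      using bij_betw_phi by (auto simp: bij_betw_def)
    show "P_order D \<subseteq> P_set D \<times> P_set D" by (auto simp: P_order_def)
  qed (rule phi_order_iff)
  then have "poset_iso (P_set D) (P_order D) (Q_set D) ((Q_order D)\<inverse>) (phi D)"
    unfolding poset_iso_def using Q bij_betw_phi phi_order_iff by blast
  moreover have "phi D (v, w) = v \<circ> wb \<circ> T (ginv w) \<circ> w0 D \<and>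
      phi D (v, w) = wb \<circ> T v \<circ> T (ginv w) \<circ> w0 D" if "(v, w) \<in> P_set D" for v w
    using phi_eq[OF P_setD(4)[OF that], of v] wb_tau_W[OF P_setD(1)[OF that]]
    by (simp only: simp_thms)
  ultimately show ?thesis by blast
qed

end
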